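(* If $f\in L^2(\mathbb R^n)$ is non-zero and log-concave, then \[\frac1{\Gamma(\beta+1)^{1/\beta}}\,\mathrm{R}_\beta f\subseteq\frac1{\Gamma(\alpha+1)^{1/\alpha}}\,\mathrm{R}_\alpha f\] for all $-1<\alpha<\beta<\infty$ (where for the index $0$ the factor $\Gamma(\alpha+1)^{1/\alpha}$ is interpreted as its limit $e^{-\gamma}$, $\gamma$ Euler's constant). There is equality if $f(x)=a\,e^{-\Vert x-x_0\Vert_\Delta}$ for $x\in\mathbb R^n$, with $a>0$, $x_0\in\mathbb R^n$ and $\Delta$ an $n$-dimensional simplex having a vertex at the origin.
   Context: Star-shaped sets are described by radial functions $\rho_K$ on $\mathbb S^{n-1}$; $\lambda K$ has radial function $\lambda\rho_K$, and $K\subseteq L$ means $\rho_K\le\rho_L$. $\Vert x\Vert_\Delta=\inf\{\lambda>0:x\in\lambda\Delta\}$. For non-negative non-zero $f\in L^2(\mathbb R^n)$: for $\alpha>0$, $\mathrm{R}_\alpha f$ is the star-shaped set with $\rho_{\mathrm{R}_\alpha f}(\xi)^\alpha=\frac{\alpha}{\Vert f\Vert_2^2}\int_0^\infty t^{\alpha-1}\int_{\mathbb R^n}f(x)f(x+t\xi)\,dx\,dt$; for $-1<\alpha<0$, $\mathrm{R}_\alpha f$ is the star-shaped set with $\rho_{\mathrm{R}_\alpha f}(\xi)^\alpha=\frac{|\alpha|}{2\Vert f\Vert_2^2}\int_0^\infty t^{\alpha-1}\int_{\mathbb R^n}|f(x+t\xi)-f(x)|^2\,dx\,dt$; and $\log\rho_{\mathrm{R}_0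 f}(\xi)=-\gamma+\int_0^\infty\frac1t\big(\frac1{\Vert f\Vert_2^2}\int_{\mathbb R^n}f(x)f(x+t\xi)\,dx-e^{-t}\big)\,dt$, with $\gamma$ Euler's constant. A log-concave function is one whose logarithm is concave with values in $[-\infty,\infty)$. *)

theory Defs
  imports "HOL-Analysis.Analysis"
begin

definition l2sq :: "('a::euclidean_space \<Rightarrow> real) \<Rightarrow> real" where
  "l2sq f = (LINT x|lebesgue. (f x)\<^sup>2)"

definition in_L2 :: "('a::euclidean_space \<Rightarrow> real) \<Rightarrow> bool" where
  "in_L2 f \<longleftrightarrow> f \<in> borel_measurable lebesgue \<and> integrable lebesgue (\<lambda>x. (f x)\<^sup>2)"

text \<open>Log-concave: f = exp o phi with phi concave with values in [-inf,inf).
  Equivalently: f \<ge> 0, the set where phi > -inf (i.e. f > 0) is convex and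
  ln f is concave there.\<close>
definition log_concave :: "('a::euclidean_space \<Rightarrow> real) \<Rightarrow> bool" where
  "log_concave f \<longleftrightarrow> (\<forall>x. 0 \<le> f x) \<and> convex {x. 0 < f x} \<and>
     concave_on {x. 0 < f x} (\<lambda>x. ln (f x))"

definition covar :: "('a::euclidean_space \<Rightarrow> real) \<Rightarrow> 'a \<Rightarrow> real" where
  "covar f y = (LINT x|lebesgue. f x * f (x + y))"

text \<open>Radial function of the radial mean body R_alpha f, evaluated at xi
  (meaningful for alpha > -1 and xi on the unit sphere).\<close>
definition radial_mean_rho :: "real \<Rightarrow> ('a::euclidean_space \<Rightarrow> real) \<Rightarrow> 'a \<Rightarrow> real" where
  "radial_mean_rho \<alpha> f \<xi> =
    (if 0 < \<alpha> then
       (\<alpha> / l2sq f * (LINT t:{0<..}|lborel. t powr (\<alpha> - 1) * covar f (t *\<^sub>R \<xi>))) powr (1 / \<alpha>)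
     else if \<alpha> < 0 then
       (\<bar>\<alpha>\<bar> / (2 * l2sq f) * (LINT t:{0<..}|lborel.
           t powr (\<alpha> - 1) * (LINT x|lebesgue. (f (x + t *\<^sub>R \<xi>) - f x)\<^sup>2))) powr (1 / \<alpha>)
     else
       exp (- euler_mascheroni + (LINT t:{0<..}|lborel.
           (1 / t) * (covar f (t *\<^sub>R \<xi>) / l2sq f - exp (- t)))))"

text \<open>Normalizing factor Gamma(alpha+1)^(1/alpha), with its limit exp(-gamma) at alpha = 0.\<close>
definition gamma_factor :: "real \<Rightarrow> real" where
  "gamma_factor \<alpha> = (if \<alpha> = 0 then exp (- euler_mascheroni) else Gamma (\<alpha> + 1) powr (1 / \<alpha>))"

text \<open>Gauge (Minkowski functional) inf {lambda > 0. x \<in> lambda Delta}, with inf of empty set = +infinity.\<close>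
definition gauge :: "'a::euclidean_space set \<Rightarrow> 'a \<Rightarrow> ereal" where
  "gauge \<Delta> x = Inf {ereal r | r. r > 0 \<and> x \<in> (\<lambda>y. r *\<^sub>R y) ` \<Delta>}"

text \<open>The function a * exp(- ||x - x0||_Delta), with exp(-infinity) = 0.\<close>
definition simplex_exp :: "real \<Rightarrow> 'a::euclidean_space \<Rightarrow> 'a set \<Rightarrow> 'a \<Rightarrow> real" where
  "simplex_exp a x0 \<Delta> x =
     (if gauge \<Delta> (x - x0) = \<infinity> then 0 else a * exp (- real_of_ereal (gauge \<Delta> (x - x0))))"

definition full_simplex_vertex0 :: "'a::euclidean_space set \<Rightarrow> bool" where
  "full_simplex_vertex0 \<Delta> \<longleftrightarrow>
     (\<exists>C. \<not> affine_dependent C \<and> card C = DIM('a) + 1 \<and> 0 \<in> C \<and> \<Delta> = convex hull C)"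

end

theory Submission
  imports Defs
begin

text \<open>
  Fix a direction \<open>\<xi>\<close> and put \<open>g t = covar f (t *\<^sub>R \<xi>) / l2sq f\<close>, so \<open>g 0 = 1\<close>. The
  Prekopa-Leindler inequality (only its midpoint form is needed) makes \<open>g\<close> midpoint log-concave;
  since \<open>f (x - v) * f (x + v)\<close> decreases as \<open>v\<close> moves away from \<open>0\<close>, \<open>g\<close> is also decreasing, and both
  together give \<open>g t powr l \<le> g (l * t)\<close> for \<open>0 < l < 1\<close>. Hence \<open>g\<close> crosses every exponential
  \<open>exp (- k t)\<close> at most once, from above to below. For such an exponential all normalized mean
  radii equal \<open>1 / k\<close>, and the normalized \<open>\<alpha>\<close>-radius of \<open>g\<close> exceeds \<open>1 / k\<close> exactly when
  \<open>\<integral> t powr (\<alpha> - 1) * (g t - exp (- k t)) dt\<close> is positive. Choosing \<open>k\<close> such that this integral vanishes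
  for \<open>\<alpha>\<close>, the single crossing makes it nonpositive for every \<open>\<beta> > \<alpha>\<close>.

  For \<open>f x = a exp (- gauge \<Delta> (x - x0))\<close> on a simplex cone, a product of \<open>f\<close> with a translate is a
  multiple of a translate of the square of \<open>f\<close>, so \<open>g\<close> itself is an exponential.
\<close>

section \<open>The Prekopa-Leindler inequality\<close>

text \<open>Continuity of \<open>g\<close> is never established, so midpoint log-concavity directly
  gives only dyadic ratios. Monotonicity closes the gap: dyadic ratios tending to \<open>l\<close>
  from above give points at or beyond \<open>l * t\<close>, where \<open>g\<close> is no larger than
  at \<open>l * t\<close>. The three index ranges have different formulas, whose integrals converge
  for different reasons. Subtracting \<open>exp (- k t)\<close> puts them on one footing: the
  difference is O(t) at 0 and decays exponentially, so its weighted integral exists for every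
  \<alpha> > -1, and what remains is an explicit Gamma or Frullani integral. The passage from
  \<alpha> to \<beta> multiplies the integrand by the increasing weight
  \<open>t powr (\<beta> - \<alpha>)\<close>. Measured against its value at the crossing, this
  weight damps the positive part before the crossing and amplifies the negative part after
  it.\<close>

lemma emeasure_lborel_vimage_double_translate:
  fixes A :: "real set"
  assumes [measurable]: "A \<in> sets borel"
  shows "2 * emeasure lborel {z. 2 * z - b \<in> A} = emeasure lborel A"
proof -
  have "emeasure lborel A = (\<integral>\<^sup>+x. indicator A x \<partial>lborel)" by simp
  also have "\<dots> = ennreal \<bar>2\<bar> * (\<integral>\<^sup>+x. indicator A (- b + 2 * x) \<partial>lborel)"
    by (rule nn_integral_real_affine) auto
  also have "(\<lambda>x. indicator A (- b + 2 * x) :: ennreal) = indicator {z. 2 * z - b \<in> A}"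
    by (auto simp: indicator_def fun_eq_iff algebra_simps)
  also have "(\<integral>\<^sup>+x. indicator {z. 2 * z - b \<in> A} x \<partial>lborel) = emeasure lborel {z. 2 * z - b \<in> A}"
    by (rule nn_integral_indicator) measurable
  finally show ?thesis by simp
qed

text \<open>The translates \<open>A + b\<close> and \<open>a + B\<close> with \<open>a\<close> close to \<open>Sup A\<close> and \<open>b\<close> close to \<open>Inf B\<close>
  overlap only in a short interval, which avoids any appeal to compactness.\<close>

lemma brunn_minkowski_real_bounded:
  fixes A B C :: "real set"
  assumes [measurable]: "A \<in> sets borel" "B \<in> sets borel" "C \<in> sets borel"
    and ne: "A \<noteq> {}" "B \<noteq> {}" and bd: "bdd_above A" "bdd_below B"
    and sub: "\<And>x y. x \<in> A \<Longrightarrow> y \<in> B \<Longrightarrow> (x + y) / 2 \<in> C"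
  shows "emeasure lborel A + emeasure lborel B \<le> 2 * emeasure lborel C"
proof (rule ennreal_le_epsilon)
  fix e :: real assume e: "0 < e"
  obtain a where a: "a \<in> A" "Sup A - e / 2 < a"
    using less_cSup_iff[OF ne(1) bd(1), of "Sup A - e/2"] e by auto
  obtain b where b: "b \<in> B" "b < Inf B + e / 2"
    using cInf_less_iff[OF ne(2) bd(2), of "Inf B + e/2"] e by auto
  \<comment> \<open>\<open>X\<close> is \<open>(A + b) / 2\<close> and \<open>Y\<close> is
    \<open>(a + B) / 2\<close>. Being sets of midpoints with one endpoint fixed, both lie in
    \<open>C\<close>, and each has half the measure of \<open>A\<close> or \<open>B\<close>.\<close>
  define X where "X = {z. 2 * z - b \<in> A}"
  define Y where "Y = {z. 2 * z - a \<in> B}"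
  have [measurable]: "X \<in> sets borel" "Y \<in> sets borel"
    unfolding X_def Y_def by measurable
  have "X \<inter> Y \<subseteq> {(a + Inf B) / 2 .. (Sup A + b) / 2}"
  proof
    fix z assume "z \<in> X \<inter> Y"
    then have "2 * z - b \<le> Sup A" "Inf B \<le> 2 * z - a"
      using cSup_upper[OF _ bd(1)] cInf_lower[OF _ bd(2)] by (auto simp: X_def Y_def)
    then show "z \<in> {(a + Inf B) / 2 .. (Sup A + b) / 2}" by auto
  qed
  then have "emeasure lborel (X \<inter> Y) \<le> emeasure lborel {(a + Inf B) / 2 .. (Sup A + b) / 2}"
    by (intro emeasure_mono) auto
  also have "\<dots> = ennreal ((Sup A + b) / 2 - (a + Inf B) / 2)"
    using cSup_upper[OF a(1) bd(1)] cInf_lower[OF b(1) bd(2)] by (intro emeasure_lborel_Icc) simp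
  also have "\<dots> \<le> ennreal (e / 2)"
    using a(2) b(2) by (intro ennreal_leI) (simp add: field_simps)
  finally have small: "emeasure lborel (X \<inter> Y) \<le> ennreal (e / 2)" .
  have "X \<union> Y \<subseteq> C"
  proof
    fix z assume "z \<in> X \<union> Y"
    then show "z \<in> C"
      using sub[of "2 * z - b" b] sub[of a "2 * z - a"] a b by (auto simp: X_def Y_def)
  qed
  then have big: "emeasure lborel (X \<union> Y) \<le> emeasure lborel C"
    by (intro emeasure_mono) auto
  have "emeasure lborel A + emeasure lborel B = 2 * (emeasure lborel X + emeasure lborel Y)"
    unfolding X_def Y_def by (simp add: emeasure_lborel_vimage_double_translate distrib_left)
  also have "emeasure lborel X + emeasure lborel Y
      = emeasure lborel (X \<union> Y) + emeasure lborel (X \<inter> Y)"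
    by (rule emeasure_Un_Int) auto
  also have "2 * \<dots> \<le> 2 * (emeasure lborel C + ennreal (e / 2))"
    by (intro mult_left_mono add_mono big small) auto
  also have "\<dots> = 2 * emeasure lborel C + ennreal e"
    using e by (simp add: distrib_left ennreal_mult'[symmetric] flip: ennreal_numeral)
  finally show "emeasure lborel A + emeasure lborel B \<le> 2 * emeasure lborel C + ennreal e" .
qed

lemma brunn_minkowski_real:
  fixes A B C :: "real set"
  assumes [measurable]: "A \<in> sets borel" "B \<in> sets borel" "C \<in> sets borel"
    and ne: "A \<noteq> {}" "B \<noteq> {}"
    and sub: "\<And>x y. x \<in> A \<Longrightarrow> y \<in> B \<Longrightarrow> (x + y) / 2 \<in> C"
  shows "emeasure lborel A + emeasure lborel B \<le> 2 * emeasure lborel C"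
proof -
  obtain a b where ab: "a \<in> A" "b \<in> B" using ne by auto
  \<comment> \<open>The bounded case needs \<open>A\<close> bounded only above and \<open>B\<close>
    only below. The terms \<open>max a\<close> and \<open>min b\<close> keep \<open>a\<close> and
    \<open>b\<close> in every truncation, so none of them is empty.\<close>
  define A' where "A' n = A \<inter> {.. max a (real n)}" for n
  define B' where "B' n = B \<inter> {min b (- real n) ..}" for n
  have [measurable]: "A' n \<in> sets borel" "B' n \<in> sets borel" for n
    unfolding A'_def B'_def by auto
  have UA: "(\<Union>n. A' n) = A"
    unfolding A'_def by (auto simp: le_max_iff_disj intro: real_arch_simple)
  have UB: "(\<Union>n. B' n) = B"
  proof
    show "B \<subseteq> (\<Union>n. B' n)"
    proof
      fix x assume "x \<in> B"
      moreover obtain n where "- x \<le> real n" using real_arch_simple by blast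
      ultimately have "x \<in> B' n" by (auto simp: B'_def min_le_iff_disj)
      then show "x \<in> (\<Union>n. B' n)" by blast
    qed
  qed (auto simp: B'_def)
  have le: "emeasure lborel (A' n) + emeasure lborel (B' n) \<le> 2 * emeasure lborel C" for n
    using ab sub unfolding A'_def B'_def
    by (intro brunn_minkowski_real_bounded) (auto intro: bdd_above_Int2 bdd_below_Int2)
  have "(\<lambda>n. emeasure lborel (A' n) + emeasure lborel (B' n))
      \<longlonglongrightarrow> emeasure lborel (\<Union>n. A' n) + emeasure lborel (\<Union>n. B' n)"
  proof (intro tendsto_add Lim_emeasure_incseq)
    show "incseq A'" "incseq B'"
      unfolding A'_def B'_def by (auto simp: incseq_def le_max_iff_disj min_le_iff_disj)
  qed auto
  then show ?thesis
    unfolding UA UB by (rule LIMSEQ_le_const2) (use le in auto)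
qed

section \<open>The one-dimensional inequality by integration over level sets\<close>

lemma nn_integral_eq_superlevel:
  fixes F :: "real \<Rightarrow> ennreal"
  assumes [measurable]: "F \<in> borel_measurable borel"
  shows "(\<integral>\<^sup>+x. F x \<partial>lborel) = (\<integral>\<^sup>+t. indicator {0<..} t * emeasure lborel {x. ennreal t < F x} \<partial>lborel)"
proof -
  \<comment> \<open>Layer-cake formula: each value is the length of the interval of positive levels
    below it, and Tonelli then exchanges points and levels.\<close>
  have F: "F x = (\<integral>\<^sup>+t. indicator {0<..} t * indicator {x. ennreal t < F x} x \<partial>lborel)" for x
  proof (cases "F x")
    case (real r)
    have "(\<integral>\<^sup>+t. indicator {0<..} t * indicator {x. ennreal t < F x} x \<partial>lborel)
        = (\<integral>\<^sup>+t. indicator {0<..<r} t \<partial>lborel)"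
      using real by (intro nn_integral_cong) (auto simp: indicator_def ennreal_less_iff)
    then show ?thesis using real by simp
  next
    case top
    have "(\<integral>\<^sup>+t. indicator {0<..} t * indicator {x. ennreal t < F x} x \<partial>lborel)
        = (\<integral>\<^sup>+t. indicator {0::real<..} t \<partial>lborel)"
      using top by (intro nn_integral_cong) (auto simp: indicator_def)
    also have "\<dots> = emeasure lborel {0::real<..}" by simp
    also have "\<dots> = \<infinity>"
    proof (rule ccontr)
      assume "emeasure lborel {0::real<..} \<noteq> \<infinity>"
      then obtain r where r: "emeasure lborel {0::real<..} = ennreal r" "0 \<le> r"
        by (cases "emeasure lborel {0::real<..}") auto
      have "emeasure lborel {0<..<r + 1} \<le> emeasure lborel {0::real<..}"
        by (intro emeasure_mono) auto
      then show False using r by simp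
    qed
    finally show ?thesis using top by simp
  qed
  have "(\<integral>\<^sup>+x. F x \<partial>lborel)
      = (\<integral>\<^sup>+x. (\<integral>\<^sup>+t. indicator {0<..} t * indicator {x. ennreal t < F x} x \<partial>lborel) \<partial>lborel)"
    by (intro nn_integral_cong F)
  also have "\<dots> = (\<integral>\<^sup>+t. (\<integral>\<^sup>+x. indicator {0<..} t * indicator {x. ennreal t < F x} x \<partial>lborel) \<partial>lborel)"
    by (rule lborel_pair.Fubini') measurable
  also have "\<dots> = (\<integral>\<^sup>+t. indicator {0<..} t * emeasure lborel {x. ennreal t < F x} \<partial>lborel)"
    by (intro nn_integral_cong, subst nn_integral_cmult) (auto intro!: arg_cong2[where f="(*)"] nn_integral_indicator)
  finally show ?thesis .
qed

lemma four_mult_le_square_add_ennreal: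
  fixes p q :: ennreal
  shows "4 * (p * q) \<le> (p + q)\<^sup>2"
proof (cases p; cases q)
  fix a b assume *: "0 \<le> a" "p = ennreal a" "0 \<le> b" "q = ennreal b"
  have "4 * (a * b) \<le> (a + b)\<^sup>2"
    using sum_squares_bound[of a b] by (simp add: power2_eq_square algebra_simps)
  then have "ennreal (4 * (a * b)) \<le> ennreal ((a + b)\<^sup>2)" by (rule ennreal_leI)
  then show ?thesis
    using * by (simp add: ennreal_mult' ennreal_power[symmetric])
qed (auto simp: power2_eq_square ennreal_mult_top ennreal_top_mult)

text \<open>Equal suprema make the superlevel sets of \<open>F\<close> and \<open>G\<close> nonempty
  for the same levels \<open>t < 1\<close> and empty for \<open>t \<ge> 1\<close>. So
  Brunn-Minkowski applies level by level, the levels integrate to an additive inequality, and the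
  arithmetic-geometric mean inequality makes it multiplicative.\<close>

lemma prekopa_leindler_real_normalized:
  fixes F G H :: "real \<Rightarrow> ennreal"
  assumes [measurable]: "F \<in> borel_measurable borel" "G \<in> borel_measurable borel" "H \<in> borel_measurable borel"
    and sup: "(SUP x. F x) = 1" "(SUP x. G x) = 1"
    and FGH: "\<And>x y. F x * G y \<le> (H ((x + y) / 2))\<^sup>2"
  shows "(\<integral>\<^sup>+x. F x \<partial>lborel) * (\<integral>\<^sup>+x. G x \<partial>lborel) \<le> (\<integral>\<^sup>+x. H x \<partial>lborel)\<^sup>2"
proof -
  have le: "indicator {0<..} t * emeasure lborel {x. ennreal t < F x}
      + indicator {0<..} t * emeasure lborel {x. ennreal t < G x}
      \<le> 2 * (indicator {0<..} t * emeasure lborel {x. ennreal t < H x})" for t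
  proof (cases "0 < t \<and> t < 1")
    case True
    then have "ennreal t < (SUP x. F x)" "ennreal t < (SUP x. G x)" by (auto simp: sup ennreal_less_one_iff)
    then have ne: "{x. ennreal t < F x} \<noteq> {}" "{x. ennreal t < G x} \<noteq> {}"
      by (auto simp: less_SUP_iff)
    have "ennreal t < H ((x + y) / 2)" if "ennreal t < F x" "ennreal t < G y" for x y
    proof (rule ccontr)
      assume "\<not> ennreal t < H ((x + y) / 2)"
      then have "(H ((x + y) / 2))\<^sup>2 \<le> ennreal t * ennreal t"
        unfolding power2_eq_square by (intro mult_mono) auto
      also have "\<dots> < F x * ennreal t"
        using that True by (intro ennreal_mult_strict_right_mono) auto
      also have "\<dots> \<le> F x * G y"
        using that by (intro mult_left_mono) auto
      finally show False using FGH[of x y] by simp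
    qed
    then have "emeasure lborel {x. ennreal t < F x} + emeasure lborel {x. ennreal t < G x}
        \<le> 2 * emeasure lborel {x. ennreal t < H x}"
      by (intro brunn_minkowski_real ne) auto
    then show ?thesis using True by simp
  next
    case False
    show ?thesis
    proof (cases "0 < t")
      case True
      then have "\<not> ennreal t < F x" "\<not> ennreal t < G x" for x
        using False SUP_upper[of x UNIV F] SUP_upper[of x UNIV G] unfolding sup
        by (auto simp: not_less intro: order_trans)
      then show ?thesis by simp
    qed simp
  qed
  have "(\<integral>\<^sup>+x. F x \<partial>lborel) + (\<integral>\<^sup>+x. G x \<partial>lborel) \<le> 2 * (\<integral>\<^sup>+x. H x \<partial>lborel)"
    unfolding nn_integral_eq_superlevel[of F, simplified] nn_integral_eq_superlevel[of G, simplified]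
      nn_integral_eq_superlevel[of H, simplified]
    by (subst nn_integral_add[symmetric], measurable, subst nn_integral_cmult[symmetric], measurable)
       (intro nn_integral_mono le)
  then have "((\<integral>\<^sup>+x. F x \<partial>lborel) + (\<integral>\<^sup>+x. G x \<partial>lborel))\<^sup>2 \<le> (2 * (\<integral>\<^sup>+x. H x \<partial>lborel))\<^sup>2"
    by (intro power_mono) auto
  then have "4 * ((\<integral>\<^sup>+x. F x \<partial>lborel) * (\<integral>\<^sup>+x. G x \<partial>lborel)) \<le> 4 * (\<integral>\<^sup>+x. H x \<partial>lborel)\<^sup>2"
    using four_mult_le_square_add_ennreal order_trans by (fastforce simp: power_mult_distrib)
  then show ?thesis by (subst (asm) ennreal_mult_le_mult_iff) auto
qed

lemma prekopa_leindler_real_bounded: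
  fixes F G H :: "real \<Rightarrow> ennreal"
  assumes [measurable]: "F \<in> borel_measurable borel" "G \<in> borel_measurable borel" "H \<in> borel_measurable borel"
    and bd: "\<And>x. F x \<le> of_nat m" "\<And>x. G x \<le> of_nat n"
    and FGH: "\<And>x y. F x * G y \<le> (H ((x + y) / 2))\<^sup>2"
  shows "(\<integral>\<^sup>+x. F x \<partial>lborel) * (\<integral>\<^sup>+x. G x \<partial>lborel) \<le> (\<integral>\<^sup>+x. H x \<partial>lborel)\<^sup>2"
proof (cases "(SUP x. F x) = 0 \<or> (SUP x. G x) = 0")
  case True
  then have "(\<forall>x. F x = 0) \<or> (\<forall>x. G x = 0)"
    using SUP_upper[of _ UNIV F] SUP_upper[of _ UNIV G] by (metis UNIV_I le_zero_eq)
  then show ?thesis by auto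
next
  case False
  have "(SUP x. F x) \<le> of_nat m" "(SUP x. G x) \<le> of_nat n"
    using bd by (auto intro: SUP_least)
  then have "(SUP x. F x) < top" "(SUP x. G x) < top"
    by (meson of_nat_less_top order_le_less_trans)+
  then obtain a b where a: "(SUP x. F x) = ennreal a" "0 \<le> a" and b: "(SUP x. G x) = ennreal b" "0 \<le> b"
    by (metis less_top_ennreal)
  with False have ab: "0 < a" "0 < b" by (auto simp: less_le)
  \<comment> \<open>The geometric mean of the two suprema is the factor for \<open>H\<close> that
    keeps the hypothesis intact when \<open>F\<close> is divided by \<open>a\<close> and
    \<open>G\<close> by \<open>b\<close>.\<close>
  define c where "c = sqrt (a * b)"
  have c: "0 < c" "c * c = a * b" using ab by (auto simp: c_def)
  define F' where "F' x = ennreal (1 / a) * F x" for x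
  define G' where "G' x = ennreal (1 / b) * G x" for x
  define H' where "H' x = ennreal (1 / c) * H x" for x
  have "(SUP x. F' x) = ennreal (1 / a) * ennreal a" "(SUP x. G' x) = ennreal (1 / b) * ennreal b"
    unfolding F'_def G'_def a(1)[symmetric] b(1)[symmetric] by (rule SUP_mult_left_ennreal[symmetric])+
  then have sup: "(SUP x. F' x) = 1" "(SUP x. G' x) = 1"
    using ab by (simp_all flip: ennreal_mult')
  have [measurable]: "F' \<in> borel_measurable borel" "G' \<in> borel_measurable borel" "H' \<in> borel_measurable borel"
    unfolding F'_def G'_def H'_def by measurable
  have scale: "ennreal (1 / a) * p * (ennreal (1 / b) * q) = ennreal (1 / (a * b)) * (p * q)" for p q
    using ab by (simp add: ennreal_mult'[symmetric] mult_ac flip: mult.assoc)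
  have scale2: "(ennreal (1 / c) * p)\<^sup>2 = ennreal (1 / (a * b)) * p\<^sup>2" for p
    using c by (simp add: power2_eq_square ennreal_mult'[symmetric] mult_ac flip: mult.assoc)
  have "F' x * G' y \<le> (H' ((x + y) / 2))\<^sup>2" for x y
    unfolding F'_def G'_def H'_def scale scale2 by (intro mult_left_mono FGH) auto
  from prekopa_leindler_real_normalized[OF _ _ _ sup this]
  have "(\<integral>\<^sup>+x. F' x \<partial>lborel) * (\<integral>\<^sup>+x. G' x \<partial>lborel) \<le> (\<integral>\<^sup>+x. H' x \<partial>lborel)\<^sup>2"
    by simp
  then have "ennreal (1 / (a * b)) * ((\<integral>\<^sup>+x. F x \<partial>lborel) * (\<integral>\<^sup>+x. G x \<partial>lborel))
      \<le> ennreal (1 / (a * b)) * (\<integral>\<^sup>+x. H x \<partial>lborel)\<^sup>2"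
    unfolding F'_def G'_def H'_def by (simp add: nn_integral_cmult scale scale2)
  then show ?thesis using ab by (subst (asm) ennreal_mult_le_mult_iff) auto
qed

lemma nn_integral_SUP_min_of_nat:
  fixes F :: "'b \<Rightarrow> ennreal"
  assumes [measurable]: "F \<in> borel_measurable M"
  shows "(\<integral>\<^sup>+x. F x \<partial>M) = (SUP n. \<integral>\<^sup>+x. min (F x) (of_nat n) \<partial>M)"
proof -
  have F: "F x = (SUP n. min (F x) (of_nat n))" for x
  proof -
    have "(SUP n. inf (F x) (of_nat n)) = inf (F x) (SUP n. of_nat n)"
      by (rule inf_SUP[symmetric])
    then show ?thesis by (simp add: inf_min[symmetric] ennreal_SUP_of_nat_eq_top)
  qed
  have "(\<integral>\<^sup>+x. F x \<partial>M) = (\<integral>\<^sup>+x. (SUP n. min (F x) (of_nat n)) \<partial>M)"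
    by (intro nn_integral_cong F)
  also have "\<dots> = (SUP n. \<integral>\<^sup>+x. min (F x) (of_nat n) \<partial>M)"
    by (rule nn_integral_monotone_convergence_SUP)
       (auto simp: incseq_def le_fun_def intro: min.coboundedI1 min.coboundedI2)
  finally show ?thesis .
qed

text \<open>Truncating \<open>F\<close> and \<open>G\<close> only lowers the left side of the
  hypothesis, so \<open>H\<close> stays untouched and the two truncation levels can go to infinity
  independently.\<close>

lemma prekopa_leindler_real:
  fixes F G H :: "real \<Rightarrow> ennreal"
  assumes [measurable]: "F \<in> borel_measurable borel" "G \<in> borel_measurable borel" "H \<in> borel_measurable borel"
    and FGH: "\<And>x y. F x * G y \<le> (H ((x + y) / 2))\<^sup>2"
  shows "(\<integral>\<^sup>+x. F x \<partial>lborel) * (\<integral>\<^sup>+x. G x \<partial>lborel) \<le> (\<integral>\<^sup>+x. H x \<partial>lborel)\<^sup>2"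
proof -
  have "(\<integral>\<^sup>+x. min (F x) (of_nat m) \<partial>lborel) * (\<integral>\<^sup>+x. min (G x) (of_nat n) \<partial>lborel)
      \<le> (\<integral>\<^sup>+x. H x \<partial>lborel)\<^sup>2" for m n
    by (rule prekopa_leindler_real_bounded[where m=m and n=n])
       (auto intro!: order_trans[OF mult_mono FGH])
  then show ?thesis
    by (simp add: nn_integral_SUP_min_of_nat[of F] nn_integral_SUP_min_of_nat[of G] SUP_mult_left_ennreal
        SUP_mult_right_ennreal SUP_le_iff)
qed

section \<open>Passage to several variables by induction on the coordinates\<close>

lemma prekopa_leindler_PiM:
  fixes F G H :: "('i \<Rightarrow> real) \<Rightarrow> ennreal"
  assumes "finite I"
    and "F \<in> borel_measurable (Pi\<^sub>M I (\<lambda>_. lborel))" "G \<in> borel_measurable (Pi\<^sub>M I (\<lambda>_. lborel))"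
      "H \<in> borel_measurable (Pi\<^sub>M I (\<lambda>_. lborel))"
    and "\<And>x y. x \<in> extensional I \<Longrightarrow> y \<in> extensional I \<Longrightarrow> F x * G y \<le> (H (\<lambda>i\<in>I. (x i + y i) / 2))\<^sup>2"
  shows "(\<integral>\<^sup>+x. F x \<partial>Pi\<^sub>M I (\<lambda>_. lborel)) * (\<integral>\<^sup>+x. G x \<partial>Pi\<^sub>M I (\<lambda>_. lborel))
    \<le> (\<integral>\<^sup>+x. H x \<partial>Pi\<^sub>M I (\<lambda>_. lborel))\<^sup>2"
  using assms
proof (induction I arbitrary: F G H)
  case empty
  interpret product_sigma_finite "\<lambda>_::'i. lborel :: real measure" by standard
  \<comment> \<open>The product over no coordinates is a single point of mass 1, so the hypothesis
    at that point is the claim.\<close>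
  have "F (\<lambda>_. undefined) * G (\<lambda>_. undefined) \<le> (H (\<lambda>_. undefined))\<^sup>2"
    using empty(4)[of "\<lambda>_. undefined" "\<lambda>_. undefined"] by (simp add: restrict_def)
  then show ?case by (simp add: nn_integral_empty)
next
  case (insert i I)
  interpret product_sigma_finite "\<lambda>_::'i. lborel :: real measure" by standard
  note [measurable] = insert.prems(1-3)
  define M where "M = Pi\<^sub>M I (\<lambda>_. lborel :: real measure)"
  interpret M: sigma_finite_measure M
    unfolding M_def by (rule sigma_finite) (rule insert.hyps)
  \<comment> \<open>\<open>S K s\<close> integrates out all coordinates but \<open>i\<close>. The
    induction hypothesis, applied to slices at heights \<open>s\<close> and \<open>u\<close>, is
    exactly the hypothesis of the one-dimensional inequality for \<open>S F\<close>,
    \<open>S G\<close> and \<open>S H\<close>.\<close>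
  define S where "S K s = (\<integral>\<^sup>+x. K (x(i := s)) \<partial>M)" for K :: "('i \<Rightarrow> real) \<Rightarrow> ennreal" and s
  have upd: "(\<lambda>(s, x). x(i := s)) \<in> lborel \<Otimes>\<^sub>M M \<rightarrow>\<^sub>M Pi\<^sub>M (insert i I) (\<lambda>_. lborel)"
    unfolding M_def by measurable
  have K: "(\<lambda>(s, x). K (x(i := s))) \<in> borel_measurable (lborel \<Otimes>\<^sub>M M)"
    if "K \<in> borel_measurable (Pi\<^sub>M (insert i I) (\<lambda>_. lborel))" for K :: "('i \<Rightarrow> real) \<Rightarrow> ennreal"
    using measurable_compose[OF upd that] by (simp add: split_beta')
  have S_meas: "S K \<in> borel_measurable borel"
    if "K \<in> borel_measurable (Pi\<^sub>M (insert i I) (\<lambda>_. lborel))" for K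
    unfolding S_def using M.borel_measurable_nn_integral[OF K[OF that]] by simp
  have sect: "(\<lambda>x. K (x(i := s))) \<in> borel_measurable M"
    if "K \<in> borel_measurable (Pi\<^sub>M (insert i I) (\<lambda>_. lborel))" for K :: "('i \<Rightarrow> real) \<Rightarrow> ennreal" and s
    using measurable_compose[OF measurable_Pair1' K[OF that], of s] by (simp add: comp_def)
  have int: "integral\<^sup>N (Pi\<^sub>M (insert i I) (\<lambda>_. lborel)) K = (\<integral>\<^sup>+s. S K s \<partial>lborel)"
    if "K \<in> borel_measurable (Pi\<^sub>M (insert i I) (\<lambda>_. lborel))" for K
    unfolding S_def M_def by (rule product_nn_integral_insert_rev) (use insert.hyps that in auto)
  have "S F s * S G u \<le> (S H ((s + u) / 2))\<^sup>2" for s u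
    unfolding S_def M_def
  proof (rule insert.IH)
    fix x y :: "'i \<Rightarrow> real" assume xy: "x \<in> extensional I" "y \<in> extensional I"
    have "(\<lambda>j\<in>insert i I. ((x(i := s)) j + (y(i := u)) j) / 2)
        = (\<lambda>j\<in>I. (x j + y j) / 2)(i := (s + u) / 2)"
      using insert.hyps by (auto simp: fun_eq_iff restrict_def)
    moreover have "x(i := s) \<in> extensional (insert i I)" "y(i := u) \<in> extensional (insert i I)"
      using xy by (auto simp: extensional_def)
    ultimately show "F (x(i := s)) * G (y(i := u)) \<le> (H ((\<lambda>j\<in>I. (x j + y j) / 2)(i := (s + u) / 2)))\<^sup>2"
      using insert.prems(4)[of "x(i := s)" "y(i := u)"] by metis
  qed (rule sect[unfolded M_def] insert.prems)+
  then show ?case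
    unfolding int[OF insert.prems(1)] int[OF insert.prems(2)] int[OF insert.prems(3)]
    by (intro prekopa_leindler_real S_meas insert.prems(1-3))
qed

lemma lborel_eq_distr_PiM:
  "(lborel :: 'a::euclidean_space measure)
    = distr (Pi\<^sub>M Basis (\<lambda>_. lborel)) borel (\<lambda>x. \<Sum>b\<in>Basis. x b *\<^sub>R b)"
  unfolding lborel_eq_real by (rule lborel_def)

lemma prekopa_leindler_lborel:
  fixes F G H :: "'a::euclidean_space \<Rightarrow> ennreal"
  assumes [measurable]: "F \<in> borel_measurable borel" "G \<in> borel_measurable borel" "H \<in> borel_measurable borel"
    and FGH: "\<And>x y. F x * G y \<le> (H ((1 / 2) *\<^sub>R (x + y)))\<^sup>2"
  shows "(\<integral>\<^sup>+x. F x \<partial>lborel) * (\<integral>\<^sup>+x. G x \<partial>lborel) \<le> (\<integral>\<^sup>+x. H x \<partial>lborel)\<^sup>2"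
proof -
  define T :: "('a \<Rightarrow> real) \<Rightarrow> 'a" where "T x = (\<Sum>b\<in>Basis. x b *\<^sub>R b)" for x
  have [measurable]: "T \<in> Pi\<^sub>M Basis (\<lambda>_. lborel) \<rightarrow>\<^sub>M borel"
    unfolding T_def by measurable
  have int: "(\<integral>\<^sup>+x. K x \<partial>lborel) = (\<integral>\<^sup>+x. K (T x) \<partial>Pi\<^sub>M Basis (\<lambda>_. lborel))"
    if [measurable]: "K \<in> borel_measurable borel" for K :: "'a \<Rightarrow> ennreal"
    by (subst lborel_eq_distr_PiM, subst nn_integral_distr) (simp_all add: T_def[symmetric, abs_def])
  have "T (\<lambda>b\<in>Basis. (x b + y b) / 2) = (1 / 2) *\<^sub>R (T x + T y)" for x y
    by (simp add: T_def scaleR_sum_right algebra_simps add_divide_distrib sum.distrib cong: sum.cong)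
  then show ?thesis
    unfolding int[OF assms(1)] int[OF assms(2)] int[OF assms(3)]
    using FGH by (intro prekopa_leindler_PiM) auto
qed

text \<open>A Lebesgue measurable function agrees almost everywhere with a Borel one; moving \<open>F\<close> and \<open>G\<close> down
  to \<open>0\<close> and \<open>H\<close> up to \<open>\<infinity>\<close> on the exceptional null set preserves the pointwise hypothesis.\<close>

lemma prekopa_leindler_lebesgue:
  fixes F G H :: "'a::euclidean_space \<Rightarrow> ennreal"
  assumes meas: "F \<in> borel_measurable lebesgue" "G \<in> borel_measurable lebesgue" "H \<in> borel_measurable lebesgue"
    and FGH: "\<And>x y. F x * G y \<le> (H ((1 / 2) *\<^sub>R (x + y)))\<^sup>2"
  shows "(\<integral>\<^sup>+x. F x \<partial>lebesgue) * (\<integral>\<^sup>+x. G x \<partial>lebesgue) \<le> (\<integral>\<^sup>+x. H x \<partial>lebesgue)\<^sup>2"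
proof -
  obtain F1 G1 H1 where [measurable]: "F1 \<in> borel_measurable borel" "G1 \<in> borel_measurable borel" "H1 \<in> borel_measurable borel"
    and ae: "AE x in lborel. F x = F1 x" "AE x in lborel. G x = G1 x" "AE x in lborel. H x = H1 x"
    using meas[THEN completion_ex_borel_measurable] by (auto simp: measurable_lborel1)
  have "AE x in lborel. F x = F1 x \<and> G x = G1 x \<and> H x = H1 x" using ae by eventually_elim auto
  then obtain N where N: "\<And>x. x \<notin> N \<Longrightarrow> F x = F1 x \<and> G x = G1 x \<and> H x = H1 x" "N \<in> null_sets lborel"
    by (rule AE_E3) auto
  then have [measurable]: "N \<in> sets borel" by (auto simp: null_sets_def)
  define F2 where "F2 x = (if x \<in> N then 0 else F1 x)" for x
  define G2 where "G2 x = (if x \<in> N then 0 else G1 x)" for x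
  define H2 where "H2 x = (if x \<in> N then top else H1 x)" for x
  have [measurable]: "F2 \<in> borel_measurable borel" "G2 \<in> borel_measurable borel" "H2 \<in> borel_measurable borel"
    unfolding F2_def G2_def H2_def by measurable
  have le: "F2 x \<le> F x" "G2 x \<le> G x" "H x \<le> H2 x" for x
    using N(1) by (auto simp: F2_def G2_def H2_def)
  have "F2 x * G2 y \<le> (H2 ((1 / 2) *\<^sub>R (x + y)))\<^sup>2" for x y
  proof -
    have "F2 x * G2 y \<le> F x * G y" by (intro mult_mono le) auto
    also note FGH
    also have "(H ((1 / 2) *\<^sub>R (x + y)))\<^sup>2 \<le> (H2 ((1 / 2) *\<^sub>R (x + y)))\<^sup>2"
      by (intro power_mono le) auto
    finally show ?thesis .
  qed
  then have "(\<integral>\<^sup>+x. F2 x \<partial>lborel) * (\<integral>\<^sup>+x. G2 x \<partial>lborel) \<le> (\<integral>\<^sup>+x. H2 x \<partial>lborel)\<^sup>2"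
    by (intro prekopa_leindler_lborel) auto
  moreover have "(\<integral>\<^sup>+x. F x \<partial>lborel) = (\<integral>\<^sup>+x. F2 x \<partial>lborel)" "(\<integral>\<^sup>+x. G x \<partial>lborel) = (\<integral>\<^sup>+x. G2 x \<partial>lborel)"
      "(\<integral>\<^sup>+x. H x \<partial>lborel) = (\<integral>\<^sup>+x. H2 x \<partial>lborel)"
    using ae AE_not_in[OF N(2)] by (auto intro!: nn_integral_cong_AE simp: F2_def G2_def H2_def)
  ultimately show ?thesis by (simp add: nn_integral_completion)
qed

section \<open>Mean radii of log-concave profiles\<close>

lemma set_integral_pos_if_pos_on_interval:
  fixes f :: "real \<Rightarrow> real"
  assumes int: "set_integrable lborel {0<..} f" and nonneg: "\<And>t. 0 < t \<Longrightarrow> 0 \<le> f t"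
    and ab: "0 \<le> a" "a < b" and pos: "\<And>t. a < t \<Longrightarrow> t < b \<Longrightarrow> 0 < f t"
  shows "0 < (LINT t:{0<..}|lborel. f t)"
proof (rule ccontr)
  assume "\<not> ?thesis"
  moreover have "0 \<le> (LINT t:{0<..}|lborel. f t)"
    unfolding set_lebesgue_integral_def by (intro integral_nonneg_AE AE_I2) (auto simp: indicator_def nonneg)
  ultimately have "(LINT t:{0<..}|lborel. f t) = 0" by simp
  then have "AE t in lborel. indicator {0<..} t *\<^sub>R f t = 0"
    unfolding set_lebesgue_integral_def using int nonneg
    by (subst (asm) integral_nonneg_eq_0_iff_AE) (auto simp: set_integrable_def indicator_def)
  then have "AE t in lborel. t \<notin> {a<..<b}"
    by eventually_elim (use ab pos in \<open>force simp: indicator_def\<close>)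
  then have "emeasure lborel {a<..<b} = 0"
    by (subst (asm) AE_iff_measurable[where N="{a<..<b}"]) auto
  then show False using ab by simp
qed

section \<open>Gamma and Frullani integrals of exponentials\<close>

lemma has_bochner_integral_Gamma_scaled:
  fixes s k :: real
  assumes "0 < s" "0 < k"
  shows "has_bochner_integral lborel (\<lambda>t. indicator {0<..} t * (t powr (s - 1) * exp (- (k * t))))
    (Gamma s * k powr - s)"
proof (rule has_bochner_integral_nn_integral)
  have "ennreal (Gamma s) = (\<integral>\<^sup>+t. ennreal (indicator {0..} t * t powr (s - 1) / exp t) \<partial>lborel)"
    using assms(1) by (rule Gamma_conv_nn_integral_real)
  also have "\<dots> = ennreal \<bar>k\<bar> * (\<integral>\<^sup>+t. ennreal (indicator {0..} (0 + k * t) * (0 + k * t) powr (s - 1) / exp (0 + k * t)) \<partial>lborel)"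
    using assms by (intro nn_integral_real_affine) auto
  also have "(\<integral>\<^sup>+t. ennreal (indicator {0..} (0 + k * t) * (0 + k * t) powr (s - 1) / exp (0 + k * t)) \<partial>lborel)
      = (\<integral>\<^sup>+t. ennreal (k powr (s - 1)) * ennreal (indicator {0<..} t * (t powr (s - 1) * exp (- (k * t)))) \<partial>lborel)"
    by (rule nn_integral_cong_AE, rule AE_mp[OF AE_lborel_singleton[of "0::real"]], rule AE_I2)
       (use assms in \<open>auto simp: indicator_def powr_mult exp_minus field_simps zero_le_mult_iff ennreal_mult'[symmetric]\<close>)
  also have "ennreal \<bar>k\<bar> * \<dots> = ennreal (k powr s) * (\<integral>\<^sup>+t. ennreal (indicator {0<..} t * (t powr (s - 1) * exp (- (k * t)))) \<partial>lborel)"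
    using assms by (subst nn_integral_cmult) (auto simp: mult.assoc[symmetric] ennreal_mult'[symmetric] powr_diff)
  finally have *: "ennreal (Gamma s) = ennreal (k powr s) * (\<integral>\<^sup>+t. ennreal (indicator {0<..} t * (t powr (s - 1) * exp (- (k * t)))) \<partial>lborel)" .
  have "ennreal (Gamma s * k powr - s) = ennreal (k powr - s) * ennreal (Gamma s)"
    using assms by (simp add: ennreal_mult' mult.commute)
  also have "\<dots> = ennreal (k powr - s * k powr s) * (\<integral>\<^sup>+t. ennreal (indicator {0<..} t * (t powr (s - 1) * exp (- (k * t)))) \<partial>lborel)"
    unfolding * by (simp add: ennreal_mult' mult.assoc)
  also have "k powr - s * k powr s = 1"
    using assms by (simp add: powr_minus)
  finally show "(\<integral>\<^sup>+t. ennreal (indicator {0<..} t * (t powr (s - 1) * exp (- (k * t)))) \<partial>lborel) = ennreal (Gamma s * k powr - s)"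
    by simp
  show "0 \<le> Gamma s * k powr - s"
    using assms Gamma_real_pos[of s] by simp
qed auto

text \<open>Tonelli applied to \<open>exp (- a t) - exp (- b t) = \<integral> t exp (- u t) du\<close> over \<open>u \<in> [a, b]\<close>.\<close>

lemma nn_integral_powr_exp_diff:
  fixes \<alpha> a b :: real
  assumes \<alpha>: "-1 < \<alpha>" and ab: "0 \<le> a" "a \<le> b"
  shows "(\<integral>\<^sup>+t. ennreal (indicator {0<..} t * (t powr (\<alpha> - 1) * (exp (- (a * t)) - exp (- (b * t))))) \<partial>lborel)
    = (\<integral>\<^sup>+u. ennreal (Gamma (\<alpha> + 1)) * ennreal (indicator {a..b} u * u powr - (\<alpha> + 1)) \<partial>lborel)"
proof -
  have inner: "ennreal (indicator {0<..} t * (t powr (\<alpha> - 1) * (exp (- (a * t)) - exp (- (b * t)))))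
    = (\<integral>\<^sup>+u. ennreal (indicator {a..b} u * (indicator {0<..} t * (t powr \<alpha> * exp (- (u * t))))) \<partial>lborel)" for t
  proof (cases "0 < t")
    case True
    have "(\<integral>\<^sup>+u. ennreal (t powr \<alpha> * exp (- (u * t))) * indicator {a..b} u \<partial>lborel)
       = ennreal (- (t powr (\<alpha> - 1) * exp (- (b * t))) - - (t powr (\<alpha> - 1) * exp (- (a * t))))"
      by (rule nn_integral_FTC_Icc)
         (use True ab in \<open>auto intro!: derivative_eq_intros simp: powr_diff\<close>)
    moreover have "(\<integral>\<^sup>+u. ennreal (indicator {a..b} u * (indicator {0<..} t * (t powr \<alpha> * exp (- (u * t))))) \<partial>lborel)
       = (\<integral>\<^sup>+u. ennreal (t powr \<alpha> * exp (- (u * t))) * indicator {a..b} u \<partial>lborel)"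
      using True by (intro nn_integral_cong) (auto simp: indicator_def)
    ultimately show ?thesis using True by (simp add: algebra_simps)
  qed simp
  have "(\<integral>\<^sup>+t. ennreal (indicator {0<..} t * (t powr (\<alpha> - 1) * (exp (- (a * t)) - exp (- (b * t))))) \<partial>lborel)
    = (\<integral>\<^sup>+u. (\<integral>\<^sup>+t. ennreal (indicator {a..b} u * (indicator {0<..} t * (t powr \<alpha> * exp (- (u * t))))) \<partial>lborel) \<partial>lborel)"
    unfolding inner by (rule lborel_pair.Fubini') measurable
  also have "\<dots> = (\<integral>\<^sup>+u. ennreal (Gamma (\<alpha> + 1)) * ennreal (indicator {a..b} u * u powr - (\<alpha> + 1)) \<partial>lborel)"
  \<comment> \<open>The point \<open>u = 0\<close>, in range when \<open>a = 0\<close>, must be left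
    out: there the inner integral is infinite, while \<open>0 powr\<close> any exponent is
    \<open>0\<close>.\<close>
  proof (rule nn_integral_cong_AE, rule AE_mp[OF AE_lborel_singleton[of "0::real"]], intro AE_I2 impI)
    fix u :: real assume "u \<noteq> 0"
    show "(\<integral>\<^sup>+t. ennreal (indicator {a..b} u * (indicator {0<..} t * (t powr \<alpha> * exp (- (u * t))))) \<partial>lborel)
      = ennreal (Gamma (\<alpha> + 1)) * ennreal (indicator {a..b} u * u powr - (\<alpha> + 1))"
    proof (cases "u \<in> {a..b}")
      case True
      with \<open>u \<noteq> 0\<close> ab have u: "0 < u" by auto
      have G: "has_bochner_integral lborel (\<lambda>t. indicator {0<..} t * (t powr \<alpha> * exp (- (u * t)))) (Gamma (\<alpha> + 1) * u powr - (\<alpha> + 1))"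
        using has_bochner_integral_Gamma_scaled[of "\<alpha> + 1" u] \<alpha> u by simp
      have "(\<integral>\<^sup>+t. ennreal (indicator {0<..} t * (t powr \<alpha> * exp (- (u * t)))) \<partial>lborel) = ennreal (Gamma (\<alpha> + 1) * u powr - (\<alpha> + 1))"
        using G by (subst nn_integral_eq_integral) (auto simp: has_bochner_integral_iff indicator_def)
      also have "\<dots> = ennreal (Gamma (\<alpha> + 1)) * ennreal (u powr - (\<alpha> + 1))"
        by (rule ennreal_mult'') simp
      finally show ?thesis using True by simp
    qed simp
  qed
  finally show ?thesis .
qed

text \<open>The previous identity with \<open>a = 0\<close>. The exponent
  \<open>- (\<alpha> + 1)\<close> exceeds -1 because \<alpha> < 0, so the outer integral over
  \<open>[0, k]\<close> is finite. This is the value of the exponential profile at a negative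
  index.\<close>

lemma has_bochner_integral_powr_one_minus_exp:
  fixes \<alpha> k :: real
  assumes \<alpha>: "-1 < \<alpha>" "\<alpha> < 0" and k: "0 < k"
  shows "has_bochner_integral lborel (\<lambda>t. indicator {0<..} t * (t powr (\<alpha> - 1) * (1 - exp (- (k * t)))))
    (Gamma (\<alpha> + 1) * k powr - \<alpha> / - \<alpha>)"
proof (rule has_bochner_integral_nn_integral)
  have G: "0 < Gamma (\<alpha> + 1)" using \<alpha> by (intro Gamma_real_pos) simp
  have "((\<lambda>u. u powr - (\<alpha> + 1)) has_integral k powr (- (\<alpha> + 1) + 1) / (- (\<alpha> + 1) + 1)) {0..k}"
    using \<alpha> k by (intro has_integral_powr_from_0) auto
  then have "(\<integral>\<^sup>+u. ennreal (indicator {0..k} u * u powr - (\<alpha> + 1)) \<partial>lborel) = ennreal (k powr (- (\<alpha> + 1) + 1) / (- (\<alpha> + 1) + 1))"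
    by (intro nn_integral_has_integral_lebesgue) auto
  then have "(\<integral>\<^sup>+u. ennreal (Gamma (\<alpha> + 1)) * ennreal (indicator {0..k} u * u powr - (\<alpha> + 1)) \<partial>lborel)
      = ennreal (Gamma (\<alpha> + 1)) * ennreal (k powr (- (\<alpha> + 1) + 1) / (- (\<alpha> + 1) + 1))"
    by (subst nn_integral_cmult) auto
  also have "\<dots> = ennreal (Gamma (\<alpha> + 1) * (k powr (- (\<alpha> + 1) + 1) / (- (\<alpha> + 1) + 1)))"
    using G by (intro ennreal_mult'[symmetric]) simp
  finally show "(\<integral>\<^sup>+t. ennreal (indicator {0<..} t * (t powr (\<alpha> - 1) * (1 - exp (- (k * t))))) \<partial>lborel) = ennreal (Gamma (\<alpha> + 1) * k powr - \<alpha> / - \<alpha>)"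
    using nn_integral_powr_exp_diff[of \<alpha> 0 k] \<alpha> k by simp
  show "0 \<le> Gamma (\<alpha> + 1) * k powr - \<alpha> / - \<alpha>"
    using G \<alpha> by (intro divide_nonneg_pos mult_nonneg_nonneg) auto
  show "AE t in lborel. 0 \<le> indicator {0<..} t * (t powr (\<alpha> - 1) * (1 - exp (- (k * t))))"
    using k by (intro AE_I2) (auto simp: indicator_def)
qed auto

text \<open>The same identity at index 0: \<open>Gamma 1 = 1\<close> leaves the integral of
  \<open>1 / u\<close> over \<open>[a, b]\<close>. The integrand has a sign only for
  \<open>a \<le> b\<close>; the other order follows by swapping \<open>a\<close> and
  \<open>b\<close>.\<close>

lemma has_bochner_integral_frullani_exp:
  fixes a b :: real
  assumes ab: "0 < a" "0 < b"
  shows "has_bochner_integral lborel (\<lambda>t. indicator {0<..} t * (1 / t * (exp (- (a * t)) - exp (- (b * t))))) (ln b - ln a)"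
proof -
  have le: "has_bochner_integral lborel (\<lambda>t. indicator {0<..} t * (1 / t * (exp (- (a * t)) - exp (- (b * t))))) (ln b - ln a)"
    if ab: "0 < a" "a \<le> b" for a b :: real
  proof (rule has_bochner_integral_nn_integral)
    have "(\<integral>\<^sup>+u. ennreal (indicator {a..b} u * u powr - 1) \<partial>lborel) = (\<integral>\<^sup>+u. ennreal (1 / u) * indicator {a..b} u \<partial>lborel)"
      using ab by (intro nn_integral_cong) (auto simp: indicator_def powr_minus field_simps)
    also have "\<dots> = ennreal (ln b - ln a)"
      by (rule nn_integral_FTC_Icc) (use ab in \<open>auto intro!: derivative_eq_intros\<close>)
    finally have "(\<integral>\<^sup>+t. ennreal (indicator {0<..} t * (t powr (0 - 1) * (exp (- (a * t)) - exp (- (b * t))))) \<partial>lborel) = ennreal (ln b - ln a)"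
      by (subst nn_integral_powr_exp_diff) (use ab in auto)
    then show "(\<integral>\<^sup>+t. ennreal (indicator {0<..} t * (1 / t * (exp (- (a * t)) - exp (- (b * t))))) \<partial>lborel) = ennreal (ln b - ln a)"
      by (rule trans[rotated]) (intro nn_integral_cong, auto simp: indicator_def powr_minus field_simps)
    show "AE t in lborel. 0 \<le> indicator {0<..} t * (1 / t * (exp (- (a * t)) - exp (- (b * t))))"
      using ab by (intro AE_I2) (auto simp: indicator_def)
  qed (use ab in auto)
  show ?thesis
  proof (cases "a \<le> b")
    case False
    then show ?thesis
      using has_bochner_integral_minus[OF le[of b a]] ab by (simp add: algebra_simps)
  qed (use le ab in auto)
qed

lemma powr_minus_powr_inverse: "0 < k \<Longrightarrow> \<alpha> \<noteq> 0 \<Longrightarrow> (k powr - \<alpha>) powr (1 / \<alpha>) = 1 / k" for k \<alpha> :: real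
  using powr_minus_divide[of k 1] by (simp add: powr_powr)

text \<open>The radial function of \<open>R\<^sub>\<alpha> f\<close> in direction \<open>\<xi>\<close> in terms of
  \<open>g t = covar f (t *\<^sub>R \<xi>) / l2sq f\<close>.\<close>

definition mean_radius :: "real \<Rightarrow> (real \<Rightarrow> real) \<Rightarrow> real" where
  "mean_radius \<alpha> g =
    (if 0 < \<alpha> then (\<alpha> * (LINT t:{0<..}|lborel. t powr (\<alpha> - 1) * g t)) powr (1 / \<alpha>)
     else if \<alpha> < 0 then (- \<alpha> * (LINT t:{0<..}|lborel. t powr (\<alpha> - 1) * (1 - g t))) powr (1 / \<alpha>)
     else exp (- euler_mascheroni + (LINT t:{0<..}|lborel. (1 / t) * (g t - exp (- t)))))"

text \<open>One integral for all indices: the difference vanishes linearly at 0, which makes up for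
  the singularity of \<open>t powr (\<alpha> - 1)\<close> down to \<alpha> > -1, and it decays at
  infinity. Each of the three formulas in \<open>mean_radius\<close> is an explicit function of
  it.\<close>

definition mellin_defect :: "(real \<Rightarrow> real) \<Rightarrow> real \<Rightarrow> real \<Rightarrow> real" where
  "mellin_defect g k \<alpha> = (LINT t:{0<..}|lborel. t powr (\<alpha> - 1) * (g t - exp (- (k * t))))"

text \<open>\<open>root\<close> is log-concavity of \<open>g\<close> restricted to pairs of points one of which is \<open>0\<close>.\<close>

locale log_concave_profile =
  fixes g :: "real \<Rightarrow> real"
  assumes nonneg: "\<And>t. 0 \<le> t \<Longrightarrow> 0 \<le> g t"
    and zero: "g 0 = 1"
    and antimono: "\<And>s t. 0 \<le> s \<Longrightarrow> s \<le> t \<Longrightarrow> g t \<le> g s"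
    and root: "\<And>t l. 0 < t \<Longrightarrow> 0 < l \<Longrightarrow> l < 1 \<Longrightarrow> g t powr l \<le> g (l * t)"
    and pos: "\<exists>t>0. 0 < g t"
    and less_one: "\<exists>t>0. g t < 1"
begin

section \<open>Bounds for a profile near 0 and at infinity\<close>

lemma le_one: "0 \<le> t \<Longrightarrow> g t \<le> 1"
  using antimono[of 0 t] zero by simp

lemma one_minus_le_linear: "\<exists>A\<ge>0. \<forall>t>0. 1 - g t \<le> A * t"
proof -
  obtain t0 where t0: "0 < t0" "0 < g t0" using pos by blast
  have ln: "ln (g t0) \<le> 0" using t0 le_one[of t0] by simp
  \<comment> \<open>The second term is the slope of the exponential through the value at
    \<open>t0\<close>, which \<open>root\<close> places below \<open>g\<close> on the interval up to
    \<open>t0\<close>. The first term makes \<open>A * t\<close> at least \<open>1\<close> beyond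
    \<open>t0\<close>.\<close>
  define A where "A = 1 / t0 - ln (g t0) / t0"
  have "A \<ge> 0" using t0 divide_right_mono[OF order_trans[OF ln zero_le_one], of t0] by (simp add: A_def)
  moreover have "1 - g t \<le> A * t" if t: "0 < t" for t
  proof (cases "t < t0")
    case True
    have "1 + t / t0 * ln (g t0) \<le> exp (t / t0 * ln (g t0))"
      by (rule exp_ge_add_one_self)
    also have "\<dots> = g t0 powr (t / t0)" using t0 by (simp add: powr_def)
    also have "\<dots> \<le> g (t / t0 * t0)" using t0 t True by (intro root) auto
    finally have "1 - g t \<le> - (ln (g t0) / t0) * t" using t0 by (simp add: field_simps)
    also have "\<dots> \<le> A * t" using t0 t by (intro mult_right_mono) (auto simp: A_def)
    finally show ?thesis .
  next
    case False
    have "1 - g t \<le> 1" using nonneg[of t] t by simp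
    also have "1 \<le> 1 / t0 * t" using False t0 by (simp add: field_simps)
    also have "\<dots> \<le> A * t" using t ln t0 by (intro mult_right_mono) (auto simp: A_def divide_nonpos_pos)
    finally show ?thesis .
  qed
  ultimately show ?thesis by blast
qed

lemma le_exponential: "\<exists>B b. 0 \<le> B \<and> 0 < b \<and> (\<forall>t>0. g t \<le> B * exp (- (b * t)))"
proof -
  obtain t1 where t1: "0 < t1" "g t1 < 1" using less_one by blast
  \<comment> \<open>\<open>g t1\<close> may be \<open>0\<close>; the lower bound
    \<open>1 / 2\<close> keeps \<open>ln q\<close> meaningful and still negative.\<close>
  define q where "q = max (g t1) (1 / 2)"
  have q: "0 < q" "q < 1" "g t1 \<le> q" using t1 by (auto simp: q_def)
  define b where "b = - ln q / t1"
  have b: "0 < b" "exp (- (b * t)) = q powr (t / t1)" for t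
    using q t1 by (auto simp: b_def powr_def field_simps)
  have "g t \<le> exp (b * t1) * exp (- (b * t))" if t: "0 < t" for t
  proof (cases "t \<le> t1")
    case True
    have "g t \<le> 1" using le_one t by simp
    also have "1 \<le> exp (b * t1 + - (b * t))" using True b(1) by simp
    finally show ?thesis by (simp add: exp_add[symmetric])
  next
    case False
    have "g t powr (t1 / t) \<le> g (t1 / t * t)" using t t1 False by (intro root) auto
    then have "g t powr (t1 / t) \<le> q" using t q(3) by simp
    then have "(g t powr (t1 / t)) powr (t / t1) \<le> q powr (t / t1)"
      using t t1 by (intro powr_mono2) auto
    then have "g t \<le> exp (- (b * t))" using t t1 nonneg[of t] by (simp add: powr_powr b(2))
    also have "\<dots> \<le> exp (b * t1) * exp (- (b * t))" using b(1) t1 by simp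
    finally show ?thesis .
  qed
  then show ?thesis using b(1) exp_ge_zero by blast
qed

text \<open>The dominating function is chosen so that its product with
  \<open>t powr (\<alpha> - 1)\<close> is a Gamma integrand of parameter \<alpha> + 1 > 0. Up to
  \<open>t = 1\<close> both functions are within O(t) of 1; beyond it both decay and
  \<open>1 \<le> t\<close> supplies the missing factor.\<close>

lemma diff_exp_bound:
  assumes k: "0 < k"
  shows "\<exists>A b. 0 < b \<and> (\<forall>t>0. \<bar>g t - exp (- (k * t))\<bar> \<le> A * (t * exp (- (b * t))))"
proof -
  obtain A where A: "0 \<le> A" "\<And>t. 0 < t \<Longrightarrow> 1 - g t \<le> A * t" using one_minus_le_linear by blast
  obtain B b0 where B: "0 \<le> B" "0 < b0" "\<And>t. 0 < t \<Longrightarrow> g t \<le> B * exp (- (b0 * t))"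
    using le_exponential by blast
  define b where "b = min b0 k"
  have b: "0 < b" "b \<le> b0" "b \<le> k" using B k by (auto simp: b_def)
  have "\<bar>g t - exp (- (k * t))\<bar> \<le> ((A + k) * exp b + (B + 1)) * (t * exp (- (b * t)))" if t: "0 < t" for t
  proof (cases "t \<le> 1")
    case True
    have "1 - exp (- (k * t)) \<le> k * t" using exp_ge_add_one_self[of "- (k * t)"] by simp
    moreover have "0 \<le> k * t" "0 \<le> A * t" using k t A by auto
    ultimately have "\<bar>g t - exp (- (k * t))\<bar> \<le> (A + k) * t"
      using A(2)[OF t] le_one[of t] t exp_le_one_iff[of "- (k * t)"] unfolding distrib_right by linarith
    \<comment> \<open>For \<open>t \<le> 1\<close> the exponent is nonnegative; this is the origin
      of \<open>exp b\<close> in the constant.\<close>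
    also have "\<dots> \<le> ((A + k) * t) * exp (b + - (b * t))"
      using mult_left_mono[of 1 "exp (b + - (b * t))" "(A + k) * t"] A(1) k t b True by simp
    also have "\<dots> = (A + k) * exp b * (t * exp (- (b * t)))"
      unfolding exp_add by (simp add: mult_ac)
    also have "\<dots> \<le> ((A + k) * exp b + (B + 1)) * (t * exp (- (b * t)))"
      using B t by (intro mult_right_mono) auto
    finally show ?thesis .
  next
    case False
    have "\<bar>g t - exp (- (k * t))\<bar> \<le> g t + exp (- (k * t))"
      using nonneg[of t] t by (simp add: abs_le_iff)
    also have "\<dots> \<le> B * exp (- (b * t)) + exp (- (b * t))"
      using B t b by (intro add_mono order_trans[OF B(3)] mult_left_mono) auto
    also have "\<dots> = (B + 1) * (1 * exp (- (b * t)))" by (simp add: algebra_simps)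
    also have "\<dots> \<le> (B + 1) * (t * exp (- (b * t)))"
      using B False by (intro mult_left_mono mult_right_mono) auto
    also have "\<dots> \<le> ((A + k) * exp b + (B + 1)) * (t * exp (- (b * t)))"
      using A k t by (intro mult_right_mono) auto
    finally show ?thesis .
  qed
  then show ?thesis using b(1) by blast
qed

text \<open>Nothing is known about \<open>g\<close> on the negative axis. Freezing it there at
  \<open>g 0\<close> gives a function that is monotone on the whole line and agrees with
  \<open>g\<close> where the integrals live.\<close>

lemma measurable_max: "(\<lambda>t. g (max 0 t)) \<in> borel_measurable borel"
proof -
  have "mono (\<lambda>t. - g (max 0 t))" by (intro monoI) (auto intro: antimono)
  then have "(\<lambda>t. - g (max 0 t)) \<in> borel_measurable borel" by (rule borel_measurable_mono)
  then show ?thesis by simp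
qed

lemma set_integrable_mellin_defect:
  assumes k: "0 < k" and \<alpha>: "-1 < \<alpha>"
  shows "set_integrable lborel {0<..} (\<lambda>t. t powr (\<alpha> - 1) * (g t - exp (- (k * t))))"
proof -
  obtain A b where b: "0 < b" and A: "\<And>t. 0 < t \<Longrightarrow> \<bar>g t - exp (- (k * t))\<bar> \<le> A * (t * exp (- (b * t)))"
    using diff_exp_bound[OF k] by blast
  have "integrable lborel (\<lambda>t. A * (indicator {0<..} t * (t powr (\<alpha> + 1 - 1) * exp (- (b * t)))))"
    using has_bochner_integral_Gamma_scaled[of "\<alpha> + 1" b] \<alpha> b
    by (intro integrable_mult_right) (auto simp: has_bochner_integral_iff)
  then show ?thesis
    unfolding set_integrable_def
  proof (rule Bochner_Integration.integrable_bound)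
    have "(\<lambda>t. indicator {0<..} t *\<^sub>R (t powr (\<alpha> - 1) * (g t - exp (- (k * t)))))
      = (\<lambda>t. indicator {0<..} t * (t powr (\<alpha> - 1) * (g (max 0 t) - exp (- (k * t)))))"
      by (auto simp: fun_eq_iff indicator_def)
    then show "(\<lambda>t. indicator {0<..} t *\<^sub>R (t powr (\<alpha> - 1) * (g t - exp (- (k * t))))) \<in> borel_measurable lborel"
      using measurable_max by simp
    show "AE t in lborel. norm (indicator {0<..} t *\<^sub>R (t powr (\<alpha> - 1) * (g t - exp (- (k * t)))))
        \<le> norm (A * (indicator {0<..} t * (t powr (\<alpha> + 1 - 1) * exp (- (b * t)))))"
    proof (rule AE_I2)
      fix t :: real
      show "norm (indicator {0<..} t *\<^sub>R (t powr (\<alpha> - 1) * (g t - exp (- (k * t)))))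
        \<le> norm (A * (indicator {0<..} t * (t powr (\<alpha> + 1 - 1) * exp (- (b * t)))))"
      proof (cases "0 < t")
        case True
        have "norm (t powr (\<alpha> - 1) * (g t - exp (- (k * t)))) \<le> t powr (\<alpha> - 1) * (A * (t * exp (- (b * t))))"
          using A[OF True] by (simp add: abs_mult mult_left_mono)
        also have "\<dots> = A * (t powr \<alpha> * exp (- (b * t)))"
          using True by (simp add: powr_diff)
        finally show ?thesis using True by simp
      qed simp
    qed
  qed
qed

section \<open>Mean radii expressed through the defect, for every rate \<open>k\<close>\<close>

lemma set_integrable_powr_mult:
  assumes \<alpha>: "0 < \<alpha>"
  shows "set_integrable lborel {0<..} (\<lambda>t. t powr (\<alpha> - 1) * g t)"
    and "0 < k \<Longrightarrow> (LINT t:{0<..}|lborel. t powr (\<alpha> - 1) * g t) = mellin_defect g k \<alpha> + Gamma \<alpha> * k powr - \<alpha>"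
proof -
  have *: "has_bochner_integral lborel (\<lambda>t. indicator {0<..} t *\<^sub>R (t powr (\<alpha> - 1) * g t))
      (mellin_defect g k \<alpha> + Gamma \<alpha> * k powr - \<alpha>)" if k: "0 < k" for k
  proof -
    have "has_bochner_integral lborel (\<lambda>t. indicator {0<..} t *\<^sub>R (t powr (\<alpha> - 1) * (g t - exp (- (k * t))))
        + indicator {0<..} t * (t powr (\<alpha> - 1) * exp (- (k * t)))) (mellin_defect g k \<alpha> + Gamma \<alpha> * k powr - \<alpha>)"
      using set_integrable_mellin_defect[OF k, of \<alpha>] has_bochner_integral_Gamma_scaled[OF \<alpha> k] \<alpha>
      unfolding mellin_defect_def set_integrable_def set_lebesgue_integral_def
      by (intro has_bochner_integral_add has_bochner_integral_integrable) auto
    then show ?thesis by (simp add: algebra_simps)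
  qed
  show "set_integrable lborel {0<..} (\<lambda>t. t powr (\<alpha> - 1) * g t)"
    using *[of 1] by (simp add: set_integrable_def has_bochner_integral_iff)
  show "(LINT t:{0<..}|lborel. t powr (\<alpha> - 1) * g t) = mellin_defect g k \<alpha> + Gamma \<alpha> * k powr - \<alpha>" if "0 < k"
    using *[OF that] by (simp add: set_lebesgue_integral_def has_bochner_integral_iff)
qed

lemma set_integrable_powr_mult_one_minus:
  assumes \<alpha>: "-1 < \<alpha>" "\<alpha> < 0"
  shows "set_integrable lborel {0<..} (\<lambda>t. t powr (\<alpha> - 1) * (1 - g t))"
    and "0 < k \<Longrightarrow> (LINT t:{0<..}|lborel. t powr (\<alpha> - 1) * (1 - g t))
      = Gamma (\<alpha> + 1) * k powr - \<alpha> / - \<alpha> - mellin_defect g k \<alpha>"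
proof -
  have *: "has_bochner_integral lborel (\<lambda>t. indicator {0<..} t *\<^sub>R (t powr (\<alpha> - 1) * (1 - g t)))
      (Gamma (\<alpha> + 1) * k powr - \<alpha> / - \<alpha> - mellin_defect g k \<alpha>)" if k: "0 < k" for k
  proof -
    have "has_bochner_integral lborel (\<lambda>t. indicator {0<..} t * (t powr (\<alpha> - 1) * (1 - exp (- (k * t))))
        - indicator {0<..} t *\<^sub>R (t powr (\<alpha> - 1) * (g t - exp (- (k * t)))))
        (Gamma (\<alpha> + 1) * k powr - \<alpha> / - \<alpha> - mellin_defect g k \<alpha>)"
      using set_integrable_mellin_defect[OF k, of \<alpha>] has_bochner_integral_powr_one_minus_exp[OF \<alpha> k] \<alpha>
      unfolding mellin_defect_def set_integrable_def set_lebesgue_integral_def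
      by (intro has_bochner_integral_diff has_bochner_integral_integrable) auto
    then show ?thesis by (simp add: algebra_simps)
  qed
  show "set_integrable lborel {0<..} (\<lambda>t. t powr (\<alpha> - 1) * (1 - g t))"
    using *[of 1] by (simp add: set_integrable_def has_bochner_integral_iff)
  show "(LINT t:{0<..}|lborel. t powr (\<alpha> - 1) * (1 - g t))
      = Gamma (\<alpha> + 1) * k powr - \<alpha> / - \<alpha> - mellin_defect g k \<alpha>" if "0 < k"
    using *[OF that] by (simp add: set_lebesgue_integral_def has_bochner_integral_iff)
qed

text \<open>Writing \<open>g - exp (- t)\<close> as \<open>g - exp (- k t)\<close> plus
  \<open>exp (- k t) - exp (- t)\<close> separates the defect from a Frullani integral of value
  \<open>- ln k\<close>. Euler's constant cancels against \<open>gamma_factor 0\<close>.\<close>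

lemma mean_radius_zero:
  assumes k: "0 < k"
  shows "mean_radius 0 g / gamma_factor 0 = exp (mellin_defect g k 0) / k"
proof -
  have "has_bochner_integral lborel (\<lambda>t. indicator {0<..} t *\<^sub>R (t powr (0 - 1) * (g t - exp (- (k * t))))
      + indicator {0<..} t * (1 / t * (exp (- (k * t)) - exp (- (1 * t))))) (mellin_defect g k 0 + (ln 1 - ln k))"
    using set_integrable_mellin_defect[OF k, of 0] has_bochner_integral_frullani_exp[OF k, of 1]
    unfolding mellin_defect_def set_integrable_def set_lebesgue_integral_def
    by (intro has_bochner_integral_add has_bochner_integral_integrable) auto
  also have "(\<lambda>t. indicator {0<..} t *\<^sub>R (t powr (0 - 1) * (g t - exp (- (k * t))))
      + indicator {0<..} t * (1 / t * (exp (- (k * t)) - exp (- (1 * t)))))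
      = (\<lambda>t. indicator {0<..} t *\<^sub>R (1 / t * (g t - exp (- t))))"
    by (auto simp: fun_eq_iff indicator_def powr_minus field_simps)
  finally have "(LINT t:{0<..}|lborel. (1 / t) * (g t - exp (- t))) = mellin_defect g k 0 - ln k"
    by (simp add: set_lebesgue_integral_def has_bochner_integral_iff)
  then show ?thesis
    using k by (simp add: mean_radius_def gamma_factor_def exp_add exp_diff exp_minus)
qed

text \<open>The formula holds with the same sign on both sides of \<open>0\<close>: for \<open>\<alpha> < 0\<close> the factor
  \<open>- \<alpha>\<close> in \<open>mean_radius\<close> cancels the sign of \<open>1 - g\<close>.\<close>

lemma mean_radius_nonzero:
  assumes \<alpha>: "-1 < \<alpha>" "\<alpha> \<noteq> 0"
  obtains Y where "0 < Y" "mean_radius \<alpha> g / gamma_factor \<alpha> = Y powr (1 / \<alpha>)"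
    "\<And>k. 0 < k \<Longrightarrow> Y = k powr - \<alpha> + \<alpha> / Gamma (\<alpha> + 1) * mellin_defect g k \<alpha>"
proof (cases "0 < \<alpha>")
  case True
  have G: "0 < Gamma (\<alpha> + 1)" using \<alpha> by (intro Gamma_real_pos) simp
  define X where "X = \<alpha> * (LINT t:{0<..}|lborel. t powr (\<alpha> - 1) * g t)"
  obtain t0 where t0: "0 < t0" "0 < g t0" using pos by blast
  have "0 < (LINT t:{0<..}|lborel. t powr (\<alpha> - 1) * g t)"
  proof (rule set_integral_pos_if_pos_on_interval[where a=0 and b=t0])
    show "0 < t powr (\<alpha> - 1) * g t" if "0 < t" "t < t0" for t
      using that t0 antimono[of t t0] by simp
  qed (use t0 nonneg set_integrable_powr_mult[OF True] in auto)
  then have X: "0 < X" using True by (simp add: X_def)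
  \<comment> \<open>The factor \<alpha> of the radius is absorbed here, so that dividing by
    \<open>Gamma (\<alpha> + 1)\<close> leaves exactly \<open>k powr - \<alpha>\<close> from the
    exponential.\<close>
  have "Gamma (\<alpha> + 1) = \<alpha> * Gamma \<alpha>"
    using True by (intro Gamma_plus1) (auto elim: nonpos_Ints_cases)
  then have "X = Gamma (\<alpha> + 1) * k powr - \<alpha> + \<alpha> * mellin_defect g k \<alpha>" if "0 < k" for k
    using set_integrable_powr_mult(2)[OF True that] by (simp add: X_def distrib_left)
  then have eq: "X / Gamma (\<alpha> + 1) = k powr - \<alpha> + \<alpha> / Gamma (\<alpha> + 1) * mellin_defect g k \<alpha>" if "0 < k" for k
    using that G by (simp add: add_divide_distrib)
  show ?thesis
  proof (rule that[OF _ _ eq])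
    show "0 < X / Gamma (\<alpha> + 1)" using X G by simp
    show "mean_radius \<alpha> g / gamma_factor \<alpha> = (X / Gamma (\<alpha> + 1)) powr (1 / \<alpha>)"
      using True X G by (simp add: mean_radius_def gamma_factor_def X_def[symmetric] powr_divide)
  qed
next
  case False
  with \<alpha> have \<alpha>': "\<alpha> < 0" by simp
  have G: "0 < Gamma (\<alpha> + 1)" using \<alpha> by (intro Gamma_real_pos) simp
  define X where "X = - \<alpha> * (LINT t:{0<..}|lborel. t powr (\<alpha> - 1) * (1 - g t))"
  obtain t1 where t1: "0 < t1" "g t1 < 1" using less_one by blast
  have "0 < (LINT t:{0<..}|lborel. t powr (\<alpha> - 1) * (1 - g t))"
  proof (rule set_integral_pos_if_pos_on_interval[where a=t1 and b="t1 + 1"])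
    show "0 < t powr (\<alpha> - 1) * (1 - g t)" if "t1 < t" "t < t1 + 1" for t
      using that t1 antimono[of t1 t] by simp
  qed (use t1 le_one set_integrable_powr_mult_one_minus[OF \<alpha>(1) \<alpha>'] in auto)
  then have X: "0 < X" using \<alpha>' by (simp add: X_def mult_neg_pos)
  have eq: "X / Gamma (\<alpha> + 1) = k powr - \<alpha> + \<alpha> / Gamma (\<alpha> + 1) * mellin_defect g k \<alpha>" if "0 < k" for k
    using set_integrable_powr_mult_one_minus(2)[OF \<alpha>(1) \<alpha>' that] G \<alpha>' by (simp add: X_def field_simps)
  show ?thesis
  proof (rule that[OF _ _ eq])
    show "0 < X / Gamma (\<alpha> + 1)" using X G by simp
    show "mean_radius \<alpha> g / gamma_factor \<alpha> = (X / Gamma (\<alpha> + 1)) powr (1 / \<alpha>)"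
      using \<alpha>' X G by (simp add: mean_radius_def gamma_factor_def powr_divide) (simp add: X_def)
  qed
qed

section \<open>Comparison with the exponential of equal normalized radius\<close>

lemma normalized_mean_radius_eq:
  assumes k: "0 < k" and \<alpha>: "-1 < \<alpha>" and D: "mellin_defect g k \<alpha> = 0"
  shows "mean_radius \<alpha> g / gamma_factor \<alpha> = 1 / k"
proof (cases "\<alpha> = 0")
  case False
  obtain Y where "mean_radius \<alpha> g / gamma_factor \<alpha> = Y powr (1 / \<alpha>)"
    "\<And>k. 0 < k \<Longrightarrow> Y = k powr - \<alpha> + \<alpha> / Gamma (\<alpha> + 1) * mellin_defect g k \<alpha>"
    using mean_radius_nonzero[OF \<alpha> False] by metis
  then show ?thesis using k D False by (simp add: powr_minus_powr_inverse)
qed (use mean_radius_zero[OF k] D in simp)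

text \<open>For negative \<alpha> two reversals cancel: the coefficient of the defect is negative,
  and so is the exponent \<open>1 / \<alpha>\<close>. The sign of the defect therefore means the
  same on both sides of 0.\<close>

lemma normalized_mean_radius_le:
  assumes k: "0 < k" and \<alpha>: "-1 < \<alpha>" and D: "mellin_defect g k \<alpha> \<le> 0"
  shows "mean_radius \<alpha> g / gamma_factor \<alpha> \<le> 1 / k"
proof (cases "\<alpha> = 0")
  case True
  then show ?thesis using mean_radius_zero[OF k] D k by (simp add: divide_right_mono)
next
  case False
  have G: "0 < Gamma (\<alpha> + 1)" using \<alpha> by (intro Gamma_real_pos) simp
  obtain Y where Y: "0 < Y" "mean_radius \<alpha> g / gamma_factor \<alpha> = Y powr (1 / \<alpha>)"
    "Y = k powr - \<alpha> + \<alpha> / Gamma (\<alpha> + 1) * mellin_defect g k \<alpha>"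
    using mean_radius_nonzero[OF \<alpha> False] k by metis
  have "Y powr (1 / \<alpha>) \<le> (k powr - \<alpha>) powr (1 / \<alpha>)"
  proof (cases "0 < \<alpha>")
    case True
    then have "\<alpha> / Gamma (\<alpha> + 1) * mellin_defect g k \<alpha> \<le> 0"
      using D G by (intro mult_nonneg_nonpos) auto
    then have "Y \<le> k powr - \<alpha>" using Y(3) by simp
    then show ?thesis using Y(1) True by (intro powr_mono2) auto
  next
    case neg: False
    have "\<alpha> / Gamma (\<alpha> + 1) \<le> 0" using neg G by (simp add: divide_nonpos_pos)
    then have "0 \<le> \<alpha> / Gamma (\<alpha> + 1) * mellin_defect g k \<alpha>"
      using D by (rule mult_nonpos_nonpos)
    then have "k powr - \<alpha> \<le> Y" using Y(3) by simp
    then show ?thesis using k neg by (intro powr_mono2') auto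
  qed
  then show ?thesis using Y(2) False k by (simp add: powr_minus_powr_inverse)
qed

text \<open>An explicit solution replaces an intermediate value argument. The normalized radius does
  not depend on \<open>k\<close>, and \<open>k\<close> is taken as its reciprocal, which is
  \<open>Y powr (- 1 / \<alpha>)\<close> for nonzero \<alpha>. Since the radius formula holds for
  every \<open>k\<close>, inserting this one forces the defect to vanish.\<close>

lemma mellin_defect_root:
  assumes \<alpha>: "-1 < \<alpha>"
  obtains k where "0 < k" "mellin_defect g k \<alpha> = 0"
proof (cases "\<alpha> = 0")
  case True
  define k where "k = gamma_factor 0 / mean_radius 0 g"
  have pos: "0 < gamma_factor 0" "0 < mean_radius 0 g" by (simp_all add: gamma_factor_def mean_radius_def)
  then have k: "0 < k" by (simp add: k_def)
  have "exp (mellin_defect g k 0) = 1"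
    using mean_radius_zero[OF k] pos by (simp add: k_def field_simps)
  then show ?thesis using that[OF k] True by simp
next
  case False
  have G: "0 < Gamma (\<alpha> + 1)" using \<alpha> by (intro Gamma_real_pos) simp
  obtain Y where Y: "0 < Y" 
    "\<And>k. 0 < k \<Longrightarrow> Y = k powr - \<alpha> + \<alpha> / Gamma (\<alpha> + 1) * mellin_defect g k \<alpha>"
    using mean_radius_nonzero[OF \<alpha> False] by metis
  define k where "k = Y powr (- 1 / \<alpha>)"
  have k: "0 < k" "k powr - \<alpha> = Y" using Y(1) False by (auto simp: k_def powr_powr)
  then have "\<alpha> / Gamma (\<alpha> + 1) * mellin_defect g k \<alpha> = 0" using Y(2)[OF k(1)] by simp
  then show ?thesis using that[OF k(1)] False G by simp
qed

text \<open>The profile crosses \<open>exp (- k t)\<close> at most once, from above to below.\<close>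

lemma exp_le_downward:
  assumes "0 < s" "s \<le> t" "exp (- (k * t)) \<le> g t"
  shows "exp (- (k * s)) \<le> g s"
proof (cases "s = t")
  case False
  have "exp (- (k * s)) = exp (- (k * t)) powr (s / t)"
    using assms by (simp add: powr_def)
  also have "\<dots> \<le> g t powr (s / t)" using assms by (intro powr_mono2) auto
  also have "\<dots> \<le> g (s / t * t)" using assms False by (intro root) auto
  finally show ?thesis using assms by simp
qed (use assms in simp)

text \<open>With a crossing at \<tau>, the \<beta>-integrand is at most
  \<open>\<tau> powr (\<beta> - \<alpha>)\<close> times the \<alpha>-integrand: before \<tau> the
  difference is nonnegative and the weight smaller, after \<tau> the difference is negative and the
  weight larger. The \<alpha>-integral is zero by assumption. Two cases have no crossing to compare
  with: \<open>g\<close> below the exponential throughout, or nowhere below it.\<close>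

lemma mellin_defect_nonpos:
  assumes k: "0 < k" and \<alpha>: "-1 < \<alpha>" "\<alpha> < \<beta>" and D: "mellin_defect g k \<alpha> = 0"
  shows "mellin_defect g k \<beta> \<le> 0"
proof -
  define h where "h t = exp (- (k * t))" for t
  have int: "set_integrable lborel {0<..} (\<lambda>t. t powr (\<gamma> - 1) * (g t - h t))" if "-1 < \<gamma>" for \<gamma>
    unfolding h_def by (rule set_integrable_mellin_defect[OF k that])
  define S where "S = {t. 0 < t \<and> h t \<le> g t}"
  have down: "s \<in> S" if "t \<in> S" "0 < s" "s \<le> t" for s t
    using that exp_le_downward[of s t k] by (auto simp: S_def h_def)
  consider "S = {}" | "\<And>t. 0 < t \<Longrightarrow> t \<in> S" | t2 s where "s \<in> S" "0 < t2" "t2 \<notin> S" by blast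
  then show ?thesis
  proof cases
    case 1
    then have "t powr (\<beta> - 1) * (g t - h t) \<le> 0" if "0 < t" for t
      using that by (auto simp: S_def mult_nonneg_nonpos)
    then have "0 \<le> (LINT t|lborel. - (indicator {0<..} t *\<^sub>R (t powr (\<beta> - 1) * (g t - h t))))"
      by (intro integral_nonneg_AE AE_I2) (auto simp: indicator_def)
    then show ?thesis
      by (simp add: mellin_defect_def set_lebesgue_integral_def h_def)
  next
    case 2
    then have nn: "0 \<le> indicator {0<..} t *\<^sub>R (t powr (\<alpha> - 1) * (g t - h t))" for t
      by (auto simp: indicator_def S_def)
    \<comment> \<open>A nonnegative integrand with integral zero vanishes almost everywhere, so
      \<open>g\<close> and \<open>h\<close> agree almost everywhere on the half-line and every other
      index gives zero too.\<close>
    have "AE t in lborel. indicator {0<..} t *\<^sub>R (t powr (\<alpha> - 1) * (g t - h t)) = 0"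
      using int[OF \<alpha>(1)] D nn unfolding mellin_defect_def set_lebesgue_integral_def set_integrable_def h_def[symmetric]
      by (subst (asm) integral_nonneg_eq_0_iff_AE) auto
    then have "AE t in lborel. indicator {0<..} t *\<^sub>R (t powr (\<beta> - 1) * (g t - h t)) = 0"
      by eventually_elim (auto simp: indicator_def)
    then have "(LINT t|lborel. indicator {0<..} t *\<^sub>R (t powr (\<beta> - 1) * (g t - h t))) = 0"
      by (rule integral_eq_zero_AE)
    then show ?thesis by (simp add: mellin_defect_def set_lebesgue_integral_def h_def)
  next
    case 3
    have le: "t \<le> t2" if "t \<in> S" for t using down[OF that 3(2)] 3(3) by force
    then have bdd: "bdd_above S" by (auto simp: bdd_above_def)
    \<comment> \<open>\<open>g\<close> may jump at the crossing, so only the sign of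
      \<open>g - h\<close> on either side of \<tau> is used, never equality at \<tau>.\<close>
    define \<tau> where "\<tau> = Sup S"
    have upper: "t \<le> \<tau>" if "t \<in> S" for t unfolding \<tau>_def using that bdd by (rule cSup_upper)
    have \<tau>: "0 < \<tau>" using upper[OF 3(1)] 3(1) by (auto simp: S_def)
    have "t powr (\<beta> - 1) * (g t - h t) \<le> \<tau> powr (\<beta> - \<alpha>) * (t powr (\<alpha> - 1) * (g t - h t))" if t: "0 < t" for t
    proof -
      have "t powr (\<beta> - \<alpha>) * (g t - h t) \<le> \<tau> powr (\<beta> - \<alpha>) * (g t - h t)"
      proof (cases "t \<in> S")
        case True
        then show ?thesis using upper[OF True] t \<alpha> by (intro mult_right_mono powr_mono2) (auto simp: S_def)
      next
        case False
        have "\<tau> \<le> t"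
        proof (rule ccontr)
          assume "\<not> \<tau> \<le> t"
          then obtain u where "u \<in> S" "t < u"
            unfolding \<tau>_def using less_cSup_iff[OF _ bdd] 3(1) by (auto simp: not_le)
          then show False using down[of u t] t False by simp
        qed
        then show ?thesis using \<tau> t \<alpha> False by (intro mult_right_mono_neg powr_mono2) (auto simp: S_def)
      qed
      then have "t powr (\<alpha> - 1) * (t powr (\<beta> - \<alpha>) * (g t - h t)) \<le> t powr (\<alpha> - 1) * (\<tau> powr (\<beta> - \<alpha>) * (g t - h t))"
        by (rule mult_left_mono) simp
      moreover have "t powr (\<beta> - 1) = t powr (\<alpha> - 1) * t powr (\<beta> - \<alpha>)"
        using t by (simp add: powr_add[symmetric])
      ultimately show ?thesis by (simp add: mult_ac)
    qed
    then have "(LINT t:{0<..}|lborel. t powr (\<beta> - 1) * (g t - h t))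
        \<le> (LINT t:{0<..}|lborel. \<tau> powr (\<beta> - \<alpha>) * (t powr (\<alpha> - 1) * (g t - h t)))"
      using \<alpha> by (intro set_integral_mono set_integrable_mult_right int) auto
    then show ?thesis using D by (simp add: mellin_defect_def h_def)
  qed
qed

lemma normalized_mean_radius_antimono:
  assumes "-1 < \<alpha>" "\<alpha> < \<beta>"
  shows "mean_radius \<beta> g / gamma_factor \<beta> \<le> mean_radius \<alpha> g / gamma_factor \<alpha>"
proof -
  obtain k where k: "0 < k" "mellin_defect g k \<alpha> = 0" using mellin_defect_root[OF assms(1)] by blast
  show ?thesis
    using normalized_mean_radius_eq[OF k(1) assms(1) k(2)] mellin_defect_nonpos[OF k(1) assms k(2)]
      normalized_mean_radius_le[OF k(1), of \<beta>] assms by simp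
qed

end

text \<open>An exponential is its own comparison function, so its defect vanishes at every
  index.\<close>

lemma normalized_mean_radius_exp:
  assumes k: "0 < k" and \<alpha>: "-1 < \<alpha>"
  shows "mean_radius \<alpha> (\<lambda>t. exp (- (k * t))) / gamma_factor \<alpha> = 1 / k"
proof -
  interpret log_concave_profile "\<lambda>t. exp (- (k * t))"
    by unfold_locales (use k in \<open>auto simp: powr_def intro!: exI[of _ 1]\<close>)
  show ?thesis by (rule normalized_mean_radius_eq[OF k \<alpha>]) (simp add: mellin_defect_def)
qed

section \<open>The covariogram\<close>

lemma measurable_lebesgue_translate: "(\<lambda>x. x + y) \<in> lebesgue \<rightarrow>\<^sub>M (lebesgue :: 'a::euclidean_space measure)"
  and distr_lebesgue_translate: "distr lebesgue lebesgue (\<lambda>x. x + y) = (lebesgue :: 'a::euclidean_space measure)"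
  using lebesgue_affine_measurable[of "\<lambda>_::'a. 1" y] lebesgue_affine_euclidean[of "\<lambda>_::'a. 1" y]
  by (simp_all add: euclidean_representation density_1 add.commute)

lemma borel_measurable_lebesgue_translate:
  fixes f :: "'a::euclidean_space \<Rightarrow> 'b::topological_space"
  assumes "f \<in> borel_measurable lebesgue"
  shows "(\<lambda>x. f (x + y)) \<in> borel_measurable lebesgue"
  using measurable_compose[OF measurable_lebesgue_translate assms] .

lemma integral_lebesgue_translate:
  fixes f :: "'a::euclidean_space \<Rightarrow> real"
  assumes "f \<in> borel_measurable lebesgue"
  shows "(LINT x|lebesgue. f (x + y)) = (LINT x|lebesgue. f x)"
  using integral_distr[OF measurable_lebesgue_translate assms, of y] by (simp add: distr_lebesgue_translate)

lemma integrable_lebesgue_translate: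
  fixes f :: "'a::euclidean_space \<Rightarrow> real"
  assumes "integrable lebesgue f"
  shows "integrable lebesgue (\<lambda>x. f (x + y))"
  by (rule integrable_distr[OF measurable_lebesgue_translate]) (simp add: distr_lebesgue_translate assms)

lemma integral_lebesgue_pos_if_pos_on_open:
  fixes f :: "'a::euclidean_space \<Rightarrow> real"
  assumes int: "integrable lebesgue f" and nonneg: "\<And>x. 0 \<le> f x"
    and U: "open U" "U \<noteq> {}" "\<And>x. x \<in> U \<Longrightarrow> 0 < f x"
  shows "0 < (LINT x|lebesgue. f x)"
proof (rule ccontr)
  assume "\<not> ?thesis"
  moreover have "0 \<le> (LINT x|lebesgue. f x)" by (simp add: nonneg)
  ultimately have "(LINT x|lebesgue. f x) = 0" by simp
  then have "AE x in lebesgue. f x = 0"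
    using int nonneg by (subst (asm) integral_nonneg_eq_0_iff_AE) auto
  then have "AE x in lebesgue. x \<notin> U"
    by eventually_elim (use U(3) in force)
  then have "negligible U"
    unfolding negligible_iff_null_sets using U(1)
    by (subst AE_iff_null_sets) auto
  then show False using open_not_negligible U by blast
qed

context
  fixes f :: "'a::euclidean_space \<Rightarrow> real"
  assumes L2: "in_L2 f"
begin

lemma in_L2_measurable: "f \<in> borel_measurable lebesgue"
  and in_L2_integrable_square: "integrable lebesgue (\<lambda>x. (f x)\<^sup>2)"
  using L2 by (auto simp: in_L2_def)

lemma integral_translate_square: "(LINT x|lebesgue. (f (x + y))\<^sup>2) = l2sq f"
  unfolding l2sq_def using in_L2_measurable
  by (intro integral_lebesgue_translate[where f="\<lambda>x. (f x)\<^sup>2"]) simp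

lemma integrable_covar: "integrable lebesgue (\<lambda>x. f (x + z) * f (x + y))"
proof (rule Bochner_Integration.integrable_bound)
  show "integrable lebesgue (\<lambda>x. (f (x + z))\<^sup>2 + (f (x + y))\<^sup>2)"
    using integrable_lebesgue_translate[OF in_L2_integrable_square]
    by (intro Bochner_Integration.integrable_add) auto
  show "(\<lambda>x. f (x + z) * f (x + y)) \<in> borel_measurable lebesgue"
    using borel_measurable_lebesgue_translate[OF in_L2_measurable] by simp
  have "\<bar>f (x + z) * f (x + y)\<bar> \<le> (f (x + z))\<^sup>2 + (f (x + y))\<^sup>2" for x
  proof -
    have "2 * (\<bar>f (x + z)\<bar> * \<bar>f (x + y)\<bar>) \<le> (f (x + z))\<^sup>2 + (f (x + y))\<^sup>2"
      using sum_squares_bound[of "\<bar>f (x + z)\<bar>" "\<bar>f (x + y)\<bar>"] by (simp add: mult.assoc)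
    moreover have "0 \<le> \<bar>f (x + z)\<bar> * \<bar>f (x + y)\<bar>" by simp
    ultimately show ?thesis unfolding abs_mult by linarith
  qed
  then show "AE x in lebesgue. norm (f (x + z) * f (x + y)) \<le> norm ((f (x + z))\<^sup>2 + (f (x + y))\<^sup>2)"
    by simp
qed

lemma covar_shift: "covar f y = (LINT x|lebesgue. f (x + z) * f (x + (z + y)))"
  unfolding covar_def
  using integral_lebesgue_translate[of "\<lambda>x. f x * f (x + y)" z] borel_measurable_lebesgue_translate[OF in_L2_measurable]
    in_L2_measurable by (simp add: add.assoc)

text \<open>Expanding the square turns the formula for negative indices into an integral of
  \<open>1 - g\<close>; the factor \<open>2\<close> meets the \<open>2\<close> in its
  normalization.\<close>

lemma integral_translate_diff_square:
  "integrable lebesgue (\<lambda>x. (f (x + y) - f x)\<^sup>2)"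
  "(LINT x|lebesgue. (f (x + y) - f x)\<^sup>2) = 2 * (l2sq f - covar f y)"
proof -
  have eq: "(f (x + y) - f x)\<^sup>2 = (f (x + y))\<^sup>2 + (f x)\<^sup>2 - 2 * (f x * f (x + y))" for x
    by (simp add: power2_eq_square algebra_simps)
  have int: "integrable lebesgue (\<lambda>x. (f (x + y))\<^sup>2)" "integrable lebesgue (\<lambda>x. f x * f (x + y))"
    using integrable_lebesgue_translate[OF in_L2_integrable_square, of y] integrable_covar[of 0 y] by simp_all
  then show "integrable lebesgue (\<lambda>x. (f (x + y) - f x)\<^sup>2)"
    unfolding eq using in_L2_integrable_square by simp
  show "(LINT x|lebesgue. (f (x + y) - f x)\<^sup>2) = 2 * (l2sq f - covar f y)"
    unfolding eq using int in_L2_integrable_square integral_translate_square[of y]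
    by (simp add: covar_def l2sq_def)
qed

lemma radial_mean_rho_eq_mean_radius:
  assumes nz: "l2sq f \<noteq> 0"
  shows "radial_mean_rho \<alpha> f \<xi> = mean_radius \<alpha> (\<lambda>t. covar f (t *\<^sub>R \<xi>) / l2sq f)"
proof -
  have "\<alpha> / l2sq f * (LINT t:{0<..}|lborel. t powr (\<alpha> - 1) * covar f (t *\<^sub>R \<xi>))
      = \<alpha> * (LINT t:{0<..}|lborel. t powr (\<alpha> - 1) * (covar f (t *\<^sub>R \<xi>) / l2sq f))"
    unfolding set_lebesgue_integral_def by simp
  moreover have "\<bar>\<alpha>\<bar> / (2 * l2sq f) * (LINT t:{0<..}|lborel.
         t powr (\<alpha> - 1) * (LINT x|lebesgue. (f (x + t *\<^sub>R \<xi>) - f x)\<^sup>2))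
      = - \<alpha> * (LINT t:{0<..}|lborel. t powr (\<alpha> - 1) * (1 - covar f (t *\<^sub>R \<xi>) / l2sq f))" if "\<alpha> < 0"
  proof -
    have eq: "t powr (\<alpha> - 1) * (1 - covar f (t *\<^sub>R \<xi>) / l2sq f)
        = t powr (\<alpha> - 1) * (LINT x|lebesgue. (f (x + t *\<^sub>R \<xi>) - f x)\<^sup>2) / (2 * l2sq f)" for t
      unfolding integral_translate_diff_square(2) using nz by (simp add: field_simps)
    show ?thesis unfolding eq set_lebesgue_integral_def using that by simp
  qed
  ultimately show ?thesis
    unfolding radial_mean_rho_def mean_radius_def by simp
qed

text \<open>If the covariogram did not drop below \<open>l2sq f\<close>, then \<open>f\<close> would
  agree almost everywhere with its translate. A ball carrying more than half of the mass of the
  square of \<open>f\<close> would then have a disjoint translate carrying as much, which exceeds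
  the total.\<close>

lemma covar_less_l2sq_far:
  assumes nz: "l2sq f \<noteq> 0" and \<xi>: "norm \<xi> = 1"
  shows "\<exists>t>0. covar f (t *\<^sub>R \<xi>) < l2sq f"
proof -
  note [measurable] = in_L2_measurable borel_measurable_lebesgue_translate[OF in_L2_measurable]
  have ball [measurable]: "ball 0 r \<in> sets (lebesgue :: 'a measure)" for r
    by (simp add: fmeasurableD)
  have l: "0 < l2sq f" using nz unfolding l2sq_def by (simp add: less_le)
  have "(\<lambda>n. LINT x|lebesgue. indicator (ball 0 (real n)) x * (f x)\<^sup>2) \<longlonglongrightarrow> (LINT x|lebesgue. (f x)\<^sup>2)"
  proof (rule integral_dominated_convergence[where w="\<lambda>x. (f x)\<^sup>2"])
    show "AE x in lebesgue. (\<lambda>n. indicator (ball 0 (real n)) x * (f x)\<^sup>2) \<longlonglongrightarrow> (f x)\<^sup>2"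
    proof (rule AE_I2)
      fix x :: 'a
      obtain N where N: "norm x < real N" using reals_Archimedean2 by blast
      then have "eventually (\<lambda>n. indicator (ball 0 (real n)) x * (f x)\<^sup>2 = (f x)\<^sup>2) sequentially"
        unfolding eventually_sequentially by (intro exI[of _ N]) (auto simp: indicator_def)
      then show "(\<lambda>n. indicator (ball 0 (real n)) x * (f x)\<^sup>2) \<longlonglongrightarrow> (f x)\<^sup>2"
        by (rule tendsto_eventually)
    qed
    show "(\<lambda>x. indicator (ball 0 (real n)) x * (f x)\<^sup>2) \<in> borel_measurable lebesgue" for n
      by measurable
  qed (use in_L2_measurable in_L2_integrable_square in \<open>auto simp: indicator_def\<close>)
  then have "eventually (\<lambda>n. l2sq f / 2 < (LINT x|lebesgue. indicator (ball 0 (real n)) x * (f x)\<^sup>2)) sequentially"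
    using l by (intro order_tendstoD) (auto simp: l2sq_def)
  then obtain n where n: "l2sq f / 2 < (LINT x|lebesgue. indicator (ball 0 (real n)) x * (f x)\<^sup>2)"
    by (auto simp: eventually_sequentially)
  define B where "B = ball (0::'a) (real n)"
  have B [measurable]: "B \<in> sets lebesgue" unfolding B_def by (rule ball)
  \<comment> \<open>The diameter of \<open>B\<close>: two points of the open ball are at distance
    less than \<open>2 * real n\<close>, so \<open>B\<close> and \<open>B + y\<close> are
    disjoint.\<close>
  define t where "t = 2 * real n"
  define y where "y = t *\<^sub>R \<xi>"
  have intB: "integrable lebesgue (\<lambda>x. indicator B x * (f x)\<^sup>2)"
    using integrable_mult_indicator[OF B in_L2_integrable_square] by simp
  have intBy: "integrable lebesgue (\<lambda>x. indicator B (x - y) * (f x)\<^sup>2)"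
    "(LINT x|lebesgue. indicator B (x - y) * (f x)\<^sup>2) = (LINT x|lebesgue. indicator B x * (f (x + y))\<^sup>2)"
  proof -
    have m: "(\<lambda>x. indicator B x * (f (x + y))\<^sup>2) \<in> borel_measurable lebesgue"
      by measurable
    then show "(LINT x|lebesgue. indicator B (x - y) * (f x)\<^sup>2) = (LINT x|lebesgue. indicator B x * (f (x + y))\<^sup>2)"
      using integral_lebesgue_translate[OF m, of "- y"] by simp
    have "integrable lebesgue (\<lambda>x. indicator B x * (f (x + y))\<^sup>2)"
      using integrable_mult_indicator[OF B integrable_lebesgue_translate[OF in_L2_integrable_square]] by simp
    from integrable_lebesgue_translate[OF this, of "- y"]
    show "integrable lebesgue (\<lambda>x. indicator B (x - y) * (f x)\<^sup>2)" by simp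
  qed
  have "0 < n"
    using n l by (cases n) auto
  then have t: "0 < t" by (simp add: t_def)
  moreover have "covar f y < l2sq f"
  proof (rule ccontr)
    assume "\<not> covar f y < l2sq f"
    then have "(LINT x|lebesgue. (f (x + y) - f x)\<^sup>2) \<le> 0"
      unfolding integral_translate_diff_square(2) by simp
    moreover have "0 \<le> (LINT x|lebesgue. (f (x + y) - f x)\<^sup>2)" by simp
    ultimately have "(LINT x|lebesgue. (f (x + y) - f x)\<^sup>2) = 0" by simp
    then have "AE x in lebesgue. (f (x + y) - f x)\<^sup>2 = 0"
      using integral_translate_diff_square(1)[of y] by (subst (asm) integral_nonneg_eq_0_iff_AE) auto
    then have "(LINT x|lebesgue. indicator B x * (f (x + y))\<^sup>2) = (LINT x|lebesgue. indicator B x * (f x)\<^sup>2)"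
      by (intro integral_cong_AE) (measurable, auto)
    then have "2 * (LINT x|lebesgue. indicator B x * (f x)\<^sup>2)
      = (LINT x|lebesgue. indicator B x * (f x)\<^sup>2 + indicator B (x - y) * (f x)\<^sup>2)"
      using intB intBy by simp
    also have "\<dots> \<le> (LINT x|lebesgue. (f x)\<^sup>2)"
    proof (rule integral_mono)
      fix x
      have "\<not> (x \<in> B \<and> x - y \<in> B)"
      proof
        assume "x \<in> B \<and> x - y \<in> B"
        then have "norm (x - (x - y)) < real n + real n"
          using norm_triangle_ineq4[of x "x - y"] by (simp add: B_def)
        then show False using \<xi> by (simp add: y_def t_def)
      qed
      then show "indicator B x * (f x)\<^sup>2 + indicator B (x - y) * (f x)\<^sup>2 \<le> (f x)\<^sup>2"
        by (auto simp: indicator_def)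
    qed (use intB intBy in_L2_integrable_square in auto)
    finally show False using n unfolding B_def l2sq_def by simp
  qed
  ultimately show ?thesis unfolding y_def by blast
qed

end

section \<open>From log-concave functions to log-concave covariograms\<close>

lemma log_concave_symmetric_antimono:
  fixes f :: "'a::euclidean_space \<Rightarrow> real"
  assumes f: "log_concave f" and s: "0 \<le> s" "s \<le> 1"
  shows "f (x - v) * f (x + v) \<le> f (x - s *\<^sub>R v) * f (x + s *\<^sub>R v)"
proof (cases "0 < f (x - v) \<and> 0 < f (x + v)")
  case True
  have cc: "concave_on {z. 0 < f z} (\<lambda>z. ln (f z))" using f by (auto simp: log_concave_def)
  \<comment> \<open>The parameter \<open>u\<close> runs along the segment from \<open>x - v\<close>
    to \<open>x + v\<close>. The points \<open>x - s v\<close> and \<open>x + s v\<close> belong to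
    \<open>u = (1 - s) / 2\<close> and \<open>u = (1 + s) / 2\<close>, whose weights are exchanged,
    so adding the two inequalities gives each endpoint total weight 1.\<close>
  have *: "ln (f (x - v)) * (1 - u) + ln (f (x + v)) * u \<le> ln (f (x + (2 * u - 1) *\<^sub>R v)) \<and> 0 < f (x + (2 * u - 1) *\<^sub>R v)"
    if u: "0 \<le> u" "u \<le> 1" for u
  proof -
    have eq: "(1 - u) *\<^sub>R (x - v) + u *\<^sub>R (x + v) = x + (2 * u - 1) *\<^sub>R v"
      by (simp add: algebra_simps) (simp add: scaleR_left_distrib[symmetric] flip: scaleR_2)
    have "(1 - u) *\<^sub>R (x - v) + u *\<^sub>R (x + v) \<in> {z. 0 < f z}"
      using f True u by (intro convexD_alt) (auto simp: log_concave_def)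
    moreover have "ln (f ((1 - u) *\<^sub>R (x - v) + u *\<^sub>R (x + v))) \<ge> (1 - u) * ln (f (x - v)) + u * ln (f (x + v))"
      using True u by (intro concave_onD[OF cc]) auto
    ultimately show ?thesis unfolding eq by (simp add: mult.commute)
  qed
  have a: "ln (f (x - v)) * (1 - (1 - s) / 2) + ln (f (x + v)) * ((1 - s) / 2) \<le> ln (f (x - s *\<^sub>R v))" "0 < f (x - s *\<^sub>R v)"
    using *[of "(1 - s) / 2"] s by (simp_all add: diff_divide_distrib)
  have b: "ln (f (x - v)) * (1 - (1 + s) / 2) + ln (f (x + v)) * ((1 + s) / 2) \<le> ln (f (x + s *\<^sub>R v))" "0 < f (x + s *\<^sub>R v)"
    using *[of "(1 + s) / 2"] s by (simp_all add: add_divide_distrib)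
  have "ln (f (x - v)) + ln (f (x + v)) \<le> ln (f (x - s *\<^sub>R v)) + ln (f (x + s *\<^sub>R v))"
    using a(1) b(1) by (simp add: field_simps)
  then have "ln (f (x - v) * f (x + v)) \<le> ln (f (x - s *\<^sub>R v) * f (x + s *\<^sub>R v))"
    using True a(2) b(2) by (simp add: ln_mult)
  then show ?thesis using True a(2) b(2) by simp
next
  case False
  have nn: "0 \<le> f z" for z using f by (auto simp: log_concave_def)
  from False have "f (x - v) = 0 \<or> f (x + v) = 0" using nn[of "x - v"] nn[of "x + v"] by linarith
  then show ?thesis using nn by auto
qed

lemma log_concave_midpoint:
  fixes f :: "'a::euclidean_space \<Rightarrow> real"
  assumes "log_concave f"
  shows "f x * f y \<le> (f ((1 / 2) *\<^sub>R (x + y)))\<^sup>2"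
proof -
  have "(1 / 2) *\<^sub>R (x + y) - (1 / 2) *\<^sub>R (y - x) = x" "(1 / 2) *\<^sub>R (x + y) + (1 / 2) *\<^sub>R (y - x) = y"
    by (simp_all add: scaleR_add_right scaleR_diff_right) (simp_all flip: scaleR_2 scaleR_left_distrib)
  then show ?thesis
    using log_concave_symmetric_antimono[OF assms, of 0 "(1 / 2) *\<^sub>R (x + y)" "(1 / 2) *\<^sub>R (y - x)"]
    by (simp add: power2_eq_square)
qed

lemma midpoint_log_concave_powr_le:
  fixes g :: "real \<Rightarrow> real"
  assumes nonneg: "\<And>t. 0 \<le> t \<Longrightarrow> 0 \<le> g t" and zero: "g 0 = 1"
    and anti: "\<And>s t. 0 \<le> s \<Longrightarrow> s \<le> t \<Longrightarrow> g t \<le> g s"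
    and mid: "\<And>s t. 0 \<le> s \<Longrightarrow> 0 \<le> t \<Longrightarrow> g s * g t \<le> (g ((s + t) / 2))\<^sup>2"
    and t: "0 < t" and l: "0 < l" "l < 1"
  shows "g t powr l \<le> g (l * t)"
proof -
  have dyadic: "g t powr (real m / 2 ^ n) \<le> g (real m / 2 ^ n * t)" if "m \<le> 2 ^ n" for m n :: nat
    using that
  proof (induction n arbitrary: m)
    case 0
    then have "m = 0 \<or> m = 1" by auto
    \<comment> \<open>For \<open>m = 0\<close> the left side is \<open>1\<close>, or
      \<open>0 powr 0 = 0\<close> when \<open>g t = 0\<close>; both are at most
      \<open>g 0 = 1\<close>.\<close>
    then show ?case using nonneg[of t] t zero by auto
  next
    case (Suc n)
    show ?case
    proof (cases "even m")
      case True
      then obtain j where "m = 2 * j" by blast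
      then show ?thesis using Suc.IH[of j] Suc.prems by simp
    next
      case False
      then obtain j where j: "m = 2 * j + 1" by (rule oddE)
      then have j2: "j + 1 \<le> 2 ^ n" using Suc.prems by simp
      \<comment> \<open>An odd numerator makes \<open>m / 2 ^ Suc n\<close> the midpoint of the
        neighbours \<open>j / 2 ^ n\<close> and \<open>(j + 1) / 2 ^ n\<close>, where the induction
        hypothesis is available.\<close>
      have "(g t powr (real m / 2 ^ Suc n))\<^sup>2 = g t powr (real j / 2 ^ n) * g t powr (real (j + 1) / 2 ^ n)"
      proof -
        have "real m / 2 ^ Suc n + real m / 2 ^ Suc n = real j / 2 ^ n + real (j + 1) / 2 ^ n"
          by (simp add: j add_divide_distrib)
        then show ?thesis unfolding power2_eq_square powr_add[symmetric] by (rule arg_cong)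
      qed
      also have "\<dots> \<le> g (real j / 2 ^ n * t) * g (real (j + 1) / 2 ^ n * t)"
        using Suc.IH[of j] Suc.IH[of "j + 1"] j2 t by (intro mult_mono nonneg) auto
      also have "\<dots> \<le> (g ((real j / 2 ^ n * t + real (j + 1) / 2 ^ n * t) / 2))\<^sup>2"
        using t by (intro mid) auto
      also have "(real j / 2 ^ n * t + real (j + 1) / 2 ^ n * t) / 2 = real m / 2 ^ Suc n * t"
        by (simp add: j field_simps)
      finally show ?thesis
        by (rule power2_le_imp_le) (use t nonneg in simp)
    qed
  qed
  show ?thesis
  proof (cases "g t = 0")
    case True
    then show ?thesis using nonneg[of "l * t"] l t by simp
  next
    case False
    \<comment> \<open>Rounding up keeps the dyadic ratios at or above \<open>l\<close>, so the
      decreasing \<open>g\<close> is at most \<open>g (l * t)\<close> at the approximating points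
      and the limit is taken only in the exponent.\<close>
    define m where "m n = nat \<lceil>l * 2 ^ n\<rceil>" for n :: nat
    have m: "l \<le> real (m n) / 2 ^ n" "real (m n) / 2 ^ n \<le> l + 1 / 2 ^ n" "m n \<le> 2 ^ n" for n
    proof -
      have "real (m n) = of_int \<lceil>l * 2 ^ n\<rceil>" using l by (simp add: m_def)
      then have "l * 2 ^ n \<le> real (m n)" "real (m n) \<le> l * 2 ^ n + 1" by linarith+
      then show "l \<le> real (m n) / 2 ^ n" "real (m n) / 2 ^ n \<le> l + 1 / 2 ^ n" by (simp_all add: field_simps)
      have "\<lceil>l * 2 ^ n\<rceil> \<le> 2 ^ n" using l by (simp add: ceiling_le_iff)
      then show "m n \<le> 2 ^ n" by (simp add: m_def nat_le_iff)
    qed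
    have "(\<lambda>n. l + 1 / 2 ^ n) \<longlonglongrightarrow> l + 0"
      by (intro tendsto_add tendsto_const LIMSEQ_divide_realpow_zero) auto
    then have lim: "(\<lambda>n. l + 1 / 2 ^ n) \<longlonglongrightarrow> l" by simp
    have "(\<lambda>n. real (m n) / 2 ^ n) \<longlonglongrightarrow> l"
      by (rule tendsto_sandwich[OF always_eventually always_eventually tendsto_const lim])
         (rule allI, rule m)+
    then have "(\<lambda>n. g t powr (real (m n) / 2 ^ n)) \<longlonglongrightarrow> g t powr l"
      using False by (intro tendsto_powr tendsto_const)
    moreover have "g t powr (real (m n) / 2 ^ n) \<le> g (l * t)" for n
    proof (rule order_trans[OF dyadic[OF m(3)]])
      show "g (real (m n) / 2 ^ n * t) \<le> g (l * t)"
        using t l m(1)[of n] by (intro anti mult_right_mono) auto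
    qed
    ultimately show ?thesis by (intro LIMSEQ_le_const2[of "\<lambda>n. g t powr (real (m n) / 2 ^ n)"]) auto
  qed
qed

context
  fixes f :: "'a::euclidean_space \<Rightarrow> real"
  assumes L2: "in_L2 f" and lc: "log_concave f"
begin

lemma log_concave_nonneg: "0 \<le> f x"
  using lc by (auto simp: log_concave_def)

lemma covar_nonneg: "0 \<le> covar f y"
  unfolding covar_def by (simp add: log_concave_nonneg)

lemma nn_integral_covar: "(\<integral>\<^sup>+x. ennreal (f x * f (x + y)) \<partial>lebesgue) = ennreal (covar f y)"
  unfolding covar_def using integrable_covar[OF L2, of 0 y]
  by (intro nn_integral_eq_integral) (auto simp: log_concave_nonneg)

text \<open>The integrand \<open>f x * f (x + y)\<close> is midpoint log-concave jointly in
  \<open>x\<close> and \<open>y\<close>; Prekopa-Leindler integrates out \<open>x\<close> and keeps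
  this property in \<open>y\<close>.\<close>

lemma covar_midpoint: "covar f y * covar f z \<le> (covar f ((1 / 2) *\<^sub>R (y + z)))\<^sup>2"
proof -
  note m = borel_measurable_lebesgue_translate[OF in_L2_measurable[OF L2]] in_L2_measurable[OF L2]
  have "ennreal (f u * f (u + y)) * ennreal (f v * f (v + z))
      \<le> (ennreal (f ((1 / 2) *\<^sub>R (u + v)) * f ((1 / 2) *\<^sub>R (u + v) + (1 / 2) *\<^sub>R (y + z))))\<^sup>2" for u v
  proof -
    have "(f u * f (u + y)) * (f v * f (v + z)) = (f u * f v) * (f (u + y) * f (v + z))" by (simp add: mult_ac)
    also have "\<dots> \<le> (f ((1 / 2) *\<^sub>R (u + v)))\<^sup>2 * (f ((1 / 2) *\<^sub>R ((u + y) + (v + z))))\<^sup>2"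
      using lc by (intro mult_mono log_concave_midpoint) (auto simp: log_concave_nonneg)
    also have "(1 / 2) *\<^sub>R ((u + y) + (v + z)) = (1 / 2) *\<^sub>R (u + v) + (1 / 2) *\<^sub>R (y + z)"
      by (simp add: algebra_simps)
    finally have "ennreal ((f u * f (u + y)) * (f v * f (v + z)))
        \<le> ennreal ((f ((1 / 2) *\<^sub>R (u + v)) * f ((1 / 2) *\<^sub>R (u + v) + (1 / 2) *\<^sub>R (y + z)))\<^sup>2)"
      by (intro ennreal_leI) (simp add: power_mult_distrib)
    then show ?thesis
      by (subst ennreal_mult'[symmetric], simp add: log_concave_nonneg, subst ennreal_power)
         (simp_all add: log_concave_nonneg)
  qed
  then have "(\<integral>\<^sup>+x. ennreal (f x * f (x + y)) \<partial>lebesgue) * (\<integral>\<^sup>+x. ennreal (f x * f (x + z)) \<partial>lebesgue)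
      \<le> (\<integral>\<^sup>+x. ennreal (f x * f (x + (1 / 2) *\<^sub>R (y + z))) \<partial>lebesgue)\<^sup>2"
    using m by (intro prekopa_leindler_lebesgue) auto
  then show ?thesis
    unfolding nn_integral_covar by (simp add: covar_nonneg ennreal_mult'[symmetric] ennreal_power)
qed

text \<open>Recentring by \<open>y / 2\<close> makes the two factors symmetric about
  \<open>x\<close>, and then the comparison holds already for the integrands.\<close>

lemma covar_antimono:
  assumes "0 \<le> s" "s \<le> 1"
  shows "covar f y \<le> covar f (s *\<^sub>R y)"
proof -
  have half: "- ((r / 2) *\<^sub>R y) + r *\<^sub>R y = (r / 2) *\<^sub>R y" for r
  proof -
    have "r *\<^sub>R y = (r / 2) *\<^sub>R y + (r / 2) *\<^sub>R y" by (simp flip: scaleR_left_distrib)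
    then show ?thesis by simp
  qed
  have "covar f y = (LINT x|lebesgue. f (x + - ((1 / 2) *\<^sub>R y)) * f (x + (1 / 2) *\<^sub>R y))"
    using covar_shift[OF L2, of y "- ((1 / 2) *\<^sub>R y)"] half[of 1] by simp
  also have "\<dots> \<le> (LINT x|lebesgue. f (x + - ((s / 2) *\<^sub>R y)) * f (x + (s / 2) *\<^sub>R y))"
    using log_concave_symmetric_antimono[OF lc assms, of _ "(1 / 2) *\<^sub>R y"]
    by (intro integral_mono integrable_covar[OF L2]) simp
  also have "\<dots> = covar f (s *\<^sub>R y)"
    using covar_shift[OF L2, of "s *\<^sub>R y" "- ((s / 2) *\<^sub>R y)"] half[of s] by simp
  finally show ?thesis .
qed

text \<open>The set where \<open>f\<close> is positive is convex and not negligible, hence contains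
  a ball of some radius \<open>r\<close>. A shift by \<open>r / 2\<close> keeps the concentric ball
  of half the radius inside it, so the integrand is positive on an open set.\<close>

lemma covar_pos_near:
  assumes nz: "l2sq f \<noteq> 0" and \<xi>: "norm \<xi> = 1"
  shows "\<exists>t>0. 0 < covar f (t *\<^sub>R \<xi>)"
proof -
  have "\<not> negligible {x. 0 < f x}"
  proof
    assume "negligible {x. 0 < f x}"
    then have "AE x in lebesgue. x \<notin> {x. 0 < f x}"
      unfolding negligible_iff_null_sets by (rule AE_not_in)
    then have "AE x in lebesgue. (f x)\<^sup>2 = 0"
      by eventually_elim (use log_concave_nonneg in \<open>auto simp: not_less intro: antisym\<close>)
    then show False using nz unfolding l2sq_def by (simp add: integral_eq_zero_AE)
  qed
  then have "interior {x. 0 < f x} \<noteq> {}"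
    using negligible_convex_interior[of "{x. 0 < f x}"] lc by (auto simp: log_concave_def)
  then obtain c where "c \<in> interior {x. 0 < f x}" by auto
  then obtain r where r: "0 < r" "ball c r \<subseteq> {x. 0 < f x}"
    by (auto simp: mem_interior)
  have "0 < covar f ((r / 2) *\<^sub>R \<xi>)"
    unfolding covar_def
  proof (rule integral_lebesgue_pos_if_pos_on_open[where U="ball c (r / 2)"])
    show "0 < f x * f (x + (r / 2) *\<^sub>R \<xi>)" if x: "x \<in> ball c (r / 2)" for x
    proof -
      have "dist c (x + (r / 2) *\<^sub>R \<xi>) \<le> dist c x + norm ((r / 2) *\<^sub>R \<xi>)"
        by (metis add_diff_cancel_left' dist_commute dist_norm dist_triangle)
      then have "x \<in> ball c r" "x + (r / 2) *\<^sub>R \<xi> \<in> ball c r"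
        using x \<xi> r by auto
      then show ?thesis using r(2) by (intro mult_pos_pos) auto
    qed
  qed (use r integrable_covar[OF L2, of 0] log_concave_nonneg in auto)
  then show ?thesis using r(1) by (intro exI[of _ "r / 2"]) simp
qed

lemma covar_log_concave_profile:
  assumes nz: "l2sq f \<noteq> 0" and \<xi>: "norm \<xi> = 1"
  shows "log_concave_profile (\<lambda>t. covar f (t *\<^sub>R \<xi>) / l2sq f)"
proof -
  define g where "g t = covar f (t *\<^sub>R \<xi>) / l2sq f" for t
  have l: "0 < l2sq f" using nz unfolding l2sq_def by (simp add: less_le)
  have nonneg: "0 \<le> g t" for t using l by (simp add: g_def covar_nonneg)
  have zero: "g 0 = 1" using nz by (simp add: g_def covar_def l2sq_def power2_eq_square)
  have anti: "g t \<le> g s" if "0 \<le> s" "s \<le> t" for s t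
  proof (cases "t = 0")
    case False
    then show ?thesis
      using covar_antimono[of "s / t" "t *\<^sub>R \<xi>"] that l by (simp add: g_def divide_right_mono)
  qed (use that in simp)
  have mid: "g s * g t \<le> (g ((s + t) / 2))\<^sup>2" for s t
    using covar_midpoint[of "s *\<^sub>R \<xi>" "t *\<^sub>R \<xi>"] l
    by (simp add: g_def power2_eq_square divide_right_mono scaleR_left_distrib[symmetric])
  have "log_concave_profile g"
  proof
    show "g t powr l \<le> g (l * t)" if "0 < t" "0 < l" "l < 1" for t l
      by (rule midpoint_log_concave_powr_le) ((rule nonneg zero mid that) | (erule (1) anti))+
    show "\<exists>t>0. 0 < g t" using covar_pos_near[OF nz \<xi>] l by (auto simp: g_def)
    show "\<exists>t>0. g t < 1" using covar_less_l2sq_far[OF L2 nz \<xi>] l by (auto simp: g_def)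
  qed ((rule nonneg zero) | (erule (1) anti))+
  then show ?thesis by (simp add: g_def[abs_def])
qed

end

section \<open>Simplex exponentials\<close>

lemma mean_radius_cong:
  assumes "\<And>t. 0 < t \<Longrightarrow> g t = h t"
  shows "mean_radius \<alpha> g = mean_radius \<alpha> h"
proof -
  have "(LINT t:{0<..}|lborel. t powr (\<alpha> - 1) * g t) = (LINT t:{0<..}|lborel. t powr (\<alpha> - 1) * h t)"
    "(LINT t:{0<..}|lborel. t powr (\<alpha> - 1) * (1 - g t)) = (LINT t:{0<..}|lborel. t powr (\<alpha> - 1) * (1 - h t))"
    "(LINT t:{0<..}|lborel. (1 / t) * (g t - exp (- t))) = (LINT t:{0<..}|lborel. (1 / t) * (h t - exp (- t)))"
    using assms by (auto intro!: set_lebesgue_integral_cong)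
  then show ?thesis unfolding mean_radius_def by simp
qed

lemma integrable_exp_neg_abs:
  assumes q: "0 < q"
  shows "integrable lborel (\<lambda>s::real. exp (- (q * \<bar>s\<bar>)))"
proof -
  define e where "e s = indicator {0<..} s * (s powr (1 - 1) * exp (- (q * s)))" for s :: real
  have e: "integrable lborel e"
    using has_bochner_integral_Gamma_scaled[of 1 q] q by (simp add: e_def[abs_def] has_bochner_integral_iff)
  then have "integrable lborel (\<lambda>s. e (0 + (- 1) * s))"
    by (rule lborel_integrable_real_affine) simp
  with e have "integrable lborel (\<lambda>s. e s + e (- s))" by simp
  then show ?thesis
  proof (rule integrable_cong_AE_imp)
    show "AE s in lborel. e s + e (- s) = exp (- (q * \<bar>s\<bar>))"
      by (rule AE_mp[OF AE_lborel_singleton[of "0::real"]], rule AE_I2)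
         (auto simp: e_def indicator_def)
  qed simp
qed

lemma integrable_exp_neg_norm:
  assumes q: "0 < q"
  shows "integrable lborel (\<lambda>x::'a::euclidean_space. exp (- (q * norm x)))"
proof (rule integrableI_bounded)
  \<comment> \<open>Each coordinate is at most the norm in absolute value, so with the rate split
    evenly over the coordinates the product of one-dimensional exponentials dominates, and its
    integral factorizes.\<close>
  define p where "p = q / DIM('a)"
  have p: "0 < p" using q by (simp add: p_def)
  interpret product_sigma_finite "\<lambda>_::'a. lborel :: real measure" by standard
  have le: "exp (- (q * norm x)) \<le> (\<Prod>b\<in>Basis. exp (- (p * \<bar>x \<bullet> b\<bar>)))" for x :: 'a
  proof -
    have "(\<Sum>b\<in>Basis. p * \<bar>x \<bullet> b\<bar>) \<le> (\<Sum>b\<in>(Basis :: 'a set). p * norm x)"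
      using p by (intro sum_mono mult_left_mono Basis_le_norm) auto
    also have "\<dots> = q * norm x" by (simp add: p_def)
    finally show ?thesis by (simp add: exp_sum[symmetric] sum_negf)
  qed
  have "(\<integral>\<^sup>+x. ennreal (norm (exp (- (q * norm (x :: 'a))))) \<partial>lborel) \<le> (\<integral>\<^sup>+x. (\<Prod>b\<in>(Basis :: 'a set). ennreal (exp (- (p * \<bar>x \<bullet> b\<bar>)))) \<partial>lborel)"
    using le by (intro nn_integral_mono) (simp add: prod_ennreal ennreal_leI)
  also have "\<dots> = (\<integral>\<^sup>+x. (\<Prod>b\<in>Basis. ennreal (exp (- (p * \<bar>x b\<bar>)))) \<partial>Pi\<^sub>M (Basis :: 'a set) (\<lambda>_. lborel))"
    by (subst lborel_eq_distr_PiM, subst nn_integral_distr)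
       (auto intro!: nn_integral_cong prod.cong simp: inner_sum_left_Basis)
  also have "\<dots> = (\<Prod>b\<in>(Basis :: 'a set). \<integral>\<^sup>+s. ennreal (exp (- (p * \<bar>s\<bar>))) \<partial>lborel)"
    by (rule product_nn_integral_prod) auto
  also have "\<dots> < \<infinity>"
  proof -
    have "(\<integral>\<^sup>+s. ennreal (exp (- (p * \<bar>s\<bar>))) \<partial>lborel) < \<infinity>"
      using integrable_exp_neg_abs[OF p] by (simp add: integrable_iff_bounded)
    then show ?thesis by (simp add: power_less_top_ennreal)
  qed
  finally show "(\<integral>\<^sup>+x. ennreal (norm (exp (- (q * norm (x :: 'a))))) \<partial>lborel) < \<infinity>" .
qed simp

text \<open>\<open>B\<close> stands for the nonzero vertices of the simplex. In the coordinates of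
  this basis the cone over the simplex is the nonnegative orthant and the gauge is the coordinate
  sum, so the computations separate into coordinates.\<close>

locale spanning_independent =
  fixes B :: "'a::euclidean_space set"
  assumes indep: "independent B" and span: "span B = UNIV"
begin

abbreviation coord :: "'a \<Rightarrow> 'a \<Rightarrow> real" where "coord x b \<equiv> representation B x b"

lemma finite_B: "finite B"
  using indep by (rule independent_imp_finite)

lemma sum_coord: "(\<Sum>b\<in>B. coord x b *\<^sub>R b) = x"
  using indep span finite_B by (intro real_vector.sum_representation_eq) auto

lemma coord_add: "coord (x + y) b = coord x b + coord y b"
  using real_vector.representation_add[OF indep, of y x] span by (simp add: fun_eq_iff add.commute)

lemma coord_scale: "coord (r *\<^sub>R x) b = r * coord x b"
  using real_vector.representation_scale[OF indep, of x r] span by (simp add: fun_eq_iff)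

lemma coord_diff: "coord (x - y) b = coord x b - coord y b"
  using coord_add[of x "(-1) *\<^sub>R y" b] by (simp only: coord_scale) simp

lemma coord_sum:
  assumes "b \<in> B"
  shows "coord (\<Sum>c\<in>B. u c *\<^sub>R c) b = u b"
proof -
  have "coord (\<Sum>c\<in>B. u c *\<^sub>R c) b = (\<Sum>c\<in>B. coord (u c *\<^sub>R c) b)"
    using real_vector.representation_sum[OF indep, of B "\<lambda>c. u c *\<^sub>R c"] span by (simp add: fun_eq_iff)
  also have "\<dots> = (\<Sum>c\<in>B. if c = b then u c else 0)"
    using real_vector.representation_basis[OF indep]
    by (intro sum.cong) (auto simp: coord_scale)
  also have "\<dots> = u b" using assms finite_B by (simp add: sum.delta)
  finally show ?thesis .
qed

lemma continuous_coord: "continuous_on S (\<lambda>x. coord x b)"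
proof -
  have "linear (\<lambda>x. coord x b)" by (rule linearI) (simp_all add: coord_add coord_scale)
  then show ?thesis by (rule linear_continuous_on_compose[OF continuous_on_id])
qed

lemma mem_scaled_simplex_iff:
  assumes r: "0 < r"
  shows "x \<in> (\<lambda>y. r *\<^sub>R y) ` (convex hull (insert 0 B)) \<longleftrightarrow> (\<forall>b\<in>B. 0 \<le> coord x b) \<and> (\<Sum>b\<in>B. coord x b) \<le> r"
proof -
  have 0: "0 \<notin> B" using indep dependent_zero by blast
  have hull: "convex hull (insert 0 B)
      = {y. \<exists>u. (\<forall>b\<in>insert 0 B. 0 \<le> u b) \<and> sum u (insert 0 B) = 1 \<and> (\<Sum>b\<in>insert 0 B. u b *\<^sub>R b) = y}"
    using finite_B by (intro convex_hull_finite) simp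
  show ?thesis
  proof
    assume "x \<in> (\<lambda>y. r *\<^sub>R y) ` (convex hull (insert 0 B))"
    then obtain u where u: "\<forall>b\<in>insert 0 B. 0 \<le> u b" "sum u (insert 0 B) = 1"
      and x: "x = r *\<^sub>R (\<Sum>b\<in>insert 0 B. u b *\<^sub>R b)" unfolding hull by auto
    have "coord x b = r * u b" if "b \<in> B" for b
      using that finite_B 0 by (simp add: x coord_scale coord_sum)
    moreover have "sum u B \<le> 1" using u finite_B 0 by simp
    ultimately show "(\<forall>b\<in>B. 0 \<le> coord x b) \<and> (\<Sum>b\<in>B. coord x b) \<le> r"
      using u r by (auto simp: sum_distrib_left[symmetric])
  next
    assume *: "(\<forall>b\<in>B. 0 \<le> coord x b) \<and> (\<Sum>b\<in>B. coord x b) \<le> r"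
    \<comment> \<open>The vertex 0 takes up the slack, which brings the total weight to 1 without
      changing the combination.\<close>
    define u where "u b = (if b = 0 then 1 - (\<Sum>b\<in>B. coord x b) / r else coord x b / r)" for b
    have uB: "u b = coord x b / r" if "b \<in> B" for b using that 0 by (auto simp: u_def)
    have "sum u B = (\<Sum>b\<in>B. coord x b) / r" by (simp add: uB sum_divide_distrib)
    then have "sum u (insert 0 B) = 1" using finite_B 0 by (simp add: u_def)
    moreover have "\<forall>b\<in>insert 0 B. 0 \<le> u b" using * r by (auto simp: u_def)
    moreover have "(\<Sum>b\<in>insert 0 B. u b *\<^sub>R b) = (1 / r) *\<^sub>R x"
    proof -
      have "(\<Sum>b\<in>insert 0 B. u b *\<^sub>R b) = (\<Sum>b\<in>B. (1 / r) *\<^sub>R (coord x b *\<^sub>R b))"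
        using finite_B 0 by (simp add: uB)
      then show ?thesis by (simp only: scaleR_sum_right[symmetric] sum_coord)
    qed
    ultimately have "(1 / r) *\<^sub>R x \<in> convex hull (insert 0 B)" unfolding hull by blast
    then show "x \<in> (\<lambda>y. r *\<^sub>R y) ` (convex hull (insert 0 B))"
      using r by (intro image_eqI[of _ _ "(1 / r) *\<^sub>R x"]) auto
  qed
qed

lemma gauge_simplex:
  "gauge (convex hull (insert 0 B)) x = (if \<forall>b\<in>B. 0 \<le> coord x b then ereal (\<Sum>b\<in>B. coord x b) else \<infinity>)"
proof (cases "\<forall>b\<in>B. 0 \<le> coord x b")
  case True
  define s where "s = (\<Sum>b\<in>B. coord x b)"
  have s: "0 \<le> s" using True by (auto simp: s_def intro: sum_nonneg)
  have "{ereal r | r. r > 0 \<and> x \<in> (\<lambda>y. r *\<^sub>R y) ` (convex hull (insert 0 B))} = {ereal r | r. r > 0 \<and> s \<le> r}"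
    using True mem_scaled_simplex_iff[of _ x] unfolding s_def by blast
  moreover have "Inf {ereal r | r. r > 0 \<and> s \<le> r} = ereal s"
  proof (rule antisym)
    \<comment> \<open>When \<open>s = 0\<close> the infimum is not attained, because of
      \<open>r > 0\<close>; hence the margin \<open>e\<close>.\<close>
    have "Inf {ereal r | r. r > 0 \<and> s \<le> r} \<le> ereal s + ereal e" if "0 < e" for e
      using s that by (intro Inf_lower) auto
    then show "Inf {ereal r | r. r > 0 \<and> s \<le> r} \<le> ereal s"
      by (rule ereal_le_epsilon2)
    show "ereal s \<le> Inf {ereal r | r. r > 0 \<and> s \<le> r}"
      by (intro Inf_greatest) auto
  qed
  ultimately show ?thesis using True by (simp add: gauge_def s_def)
next
  case False
  then have empty: "{ereal r | r. r > 0 \<and> x \<in> (\<lambda>y. r *\<^sub>R y) ` (convex hull (insert 0 B))} = {}"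
    using mem_scaled_simplex_iff[of _ x] by blast
  show ?thesis unfolding gauge_def empty if_not_P[OF False] by (simp add: top_ereal_def)
qed

context
  fixes a :: real and x0 :: 'a
  assumes a: "0 < a"
begin

abbreviation "f \<equiv> simplex_exp a x0 (convex hull (insert 0 B))"

lemma simplex_exp_eq:
  "f x = (if \<forall>b\<in>B. 0 \<le> coord (x - x0) b then a * exp (- (\<Sum>b\<in>B. coord (x - x0) b)) else 0)"
  by (simp add: simplex_exp_def gauge_simplex)

lemma simplex_exp_measurable: "f \<in> borel_measurable borel"
proof -
  have [measurable]: "(\<lambda>x. coord (x - x0) b) \<in> borel_measurable borel" for b
    using continuous_coord[of UNIV b]
    by (intro borel_measurable_continuous_onI continuous_on_compose2[OF continuous_coord[of UNIV b]] continuous_intros) auto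
  have "{x. \<forall>b\<in>B. 0 \<le> coord (x - x0) b} = (\<Inter>b\<in>B. {x. 0 \<le> coord (x - x0) b})" by auto
  also have "\<dots> \<in> sets borel"
  proof (cases "B = {}")
    case False
    then show ?thesis using finite_B by (intro sets.finite_INT) auto
  qed simp
  finally have [measurable]: "{x. \<forall>b\<in>B. 0 \<le> coord (x - x0) b} \<in> sets borel" .
  have "(\<lambda>x. indicator {x. \<forall>b\<in>B. 0 \<le> coord (x - x0) b} x * (a * exp (- (\<Sum>b\<in>B. coord (x - x0) b)))) \<in> borel_measurable borel"
    by measurable
  also have "(\<lambda>x. indicator {x. \<forall>b\<in>B. 0 \<le> coord (x - x0) b} x * (a * exp (- (\<Sum>b\<in>B. coord (x - x0) b)))) = f"
    by (auto simp: fun_eq_iff simplex_exp_eq indicator_def)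
  finally show ?thesis .
qed

lemma in_L2_simplex_exp: "in_L2 f"
proof -
  \<comment> \<open>On the cone the norm is at most \<open>K\<close> times the coordinate sum, so
    \<open>f\<close> decays exponentially in the norm there; the summand \<open>1\<close> keeps
    \<open>K\<close> positive.\<close>
  define K where "K = 1 + (\<Sum>b\<in>B. norm b)"
  have K: "0 < K" by (simp add: K_def add_pos_nonneg sum_nonneg)
  have nK: "norm b \<le> K" if "b \<in> B" for b
    using member_le_sum[of b B norm] that finite_B by (simp add: K_def)
  have bound: "(f x)\<^sup>2 \<le> a\<^sup>2 * exp (- (2 / K * norm (x - x0)))" for x
  proof (cases "\<forall>b\<in>B. 0 \<le> coord (x - x0) b")
    case True
    have "norm (x - x0) = norm (\<Sum>b\<in>B. coord (x - x0) b *\<^sub>R b)" by (simp only: sum_coord)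
    also have "\<dots> \<le> (\<Sum>b\<in>B. norm (coord (x - x0) b *\<^sub>R b))" by (rule norm_sum)
    also have "\<dots> \<le> (\<Sum>b\<in>B. coord (x - x0) b * K)"
      using True nK by (intro sum_mono) (auto intro: mult_left_mono)
    also have "\<dots> = (\<Sum>b\<in>B. coord (x - x0) b) * K" by (rule sum_distrib_right[symmetric])
    finally have "norm (x - x0) / K \<le> (\<Sum>b\<in>B. coord (x - x0) b)" using K by (simp add: pos_divide_le_eq)
    then have "- (2 * (\<Sum>b\<in>B. coord (x - x0) b)) \<le> - (2 / K * norm (x - x0))" by simp
    then have "exp (- (2 * (\<Sum>b\<in>B. coord (x - x0) b))) \<le> exp (- (2 / K * norm (x - x0)))" by (rule exp_le_cancel_iff[THEN iffD2])
    moreover have "(f x)\<^sup>2 = a\<^sup>2 * exp (- (2 * (\<Sum>b\<in>B. coord (x - x0) b)))"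
      using True by (simp add: simplex_exp_eq power_mult_distrib exp_double[symmetric])
    ultimately show ?thesis by (simp add: mult_left_mono)
  next
    case False
    then have "f x = 0" by (simp add: simplex_exp_eq del: not_all ball_simps)
    then show ?thesis by simp
  qed
  have m: "f \<in> borel_measurable lebesgue" using simplex_exp_measurable by (simp add: measurable_completion)
  have "integrable lebesgue (\<lambda>x::'a. exp (- (2 / K * norm x)))"
    using integrable_exp_neg_norm[of "2 / K"] K by (subst integrable_completion) auto
  from integrable_lebesgue_translate[OF this, of "- x0"]
  have "integrable lebesgue (\<lambda>x. a\<^sup>2 * exp (- (2 / K * norm (x - x0))))" by simp
  then have "integrable lebesgue (\<lambda>x. (f x)\<^sup>2)"
    by (rule Bochner_Integration.integrable_bound) (use m bound in auto)
  then show ?thesis using m by (simp add: in_L2_def)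
qed

lemma l2sq_simplex_exp_pos: "0 < l2sq f"
  unfolding l2sq_def
proof (rule integral_lebesgue_pos_if_pos_on_open)
  define U where "U = {x. \<forall>b\<in>B. 0 < coord (x - x0) b}"
  have "U = (\<Inter>b\<in>B. {x. 0 < coord (x - x0) b})" by (auto simp: U_def)
  also have "open \<dots>"
    using finite_B
    by (intro open_INT ballI open_Collect_less continuous_on_const
        continuous_on_compose2[OF continuous_coord[of UNIV]] continuous_intros) auto
  finally show "open U" .
  have "x0 + (\<Sum>b\<in>B. 1 *\<^sub>R b) \<in> U"
    unfolding U_def by (auto simp: coord_sum[of _ "\<lambda>_. 1", simplified])
  then show "U \<noteq> {}" by blast
  show "0 < (f x)\<^sup>2" if "x \<in> U" for x
    using that a by (auto simp: U_def simplex_exp_eq less_imp_le)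
  show "integrable lebesgue (\<lambda>x. (f x)\<^sup>2)" using in_L2_simplex_exp by (simp add: in_L2_def)
qed simp

text \<open>With \<open>m\<close> the negative part of \<open>y\<close> in the basis \<open>B\<close>, the supports of \<open>f\<close> and of its translate
  meet in the support of \<open>f\<close> translated by \<open>m\<close>.\<close>

lemma covar_simplex_exp: "covar f y = exp (- (\<Sum>b\<in>B. \<bar>coord y b\<bar>)) * l2sq f"
proof -
  define m where "m = (\<Sum>b\<in>B. max 0 (- coord y b) *\<^sub>R b)"
  have cm: "coord m b = max 0 (- coord y b)" if "b \<in> B" for b
    unfolding m_def by (rule coord_sum[OF that])
  have eq: "f x * f (x + y) = exp (- (\<Sum>b\<in>B. \<bar>coord y b\<bar>)) * (f (x + - m))\<^sup>2" for x
  proof -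
    define z where "z b = coord (x - x0) b" for b
    have z1: "coord (x + y - x0) b = z b + coord y b" for b
      unfolding z_def by (simp add: coord_diff coord_add)
    have z2: "coord (x + - m - x0) b = z b - max 0 (- coord y b)" if "b \<in> B" for b
      unfolding z_def using cm[OF that] by (simp add: coord_diff)
    have iff: "(\<forall>b\<in>B. 0 \<le> coord (x + - m - x0) b) \<longleftrightarrow> (\<forall>b\<in>B. 0 \<le> z b) \<and> (\<forall>b\<in>B. 0 \<le> z b + coord y b)"
    proof -
      have "0 \<le> coord (x + - m - x0) b \<longleftrightarrow> 0 \<le> z b \<and> 0 \<le> z b + coord y b" if "b \<in> B" for b
        unfolding z2[OF that] by auto
      then show ?thesis by blast
    qed
    show ?thesis
    proof (cases "(\<forall>b\<in>B. 0 \<le> z b) \<and> (\<forall>b\<in>B. 0 \<le> z b + coord y b)")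
      case True
      \<comment> \<open>Coordinatewise, with \<open>c = coord y b\<close>, this is
        \<open>z + (z + c) = \<bar>c\<bar> + 2 * (z - max 0 (- c))\<close>.\<close>
      have "(\<Sum>b\<in>B. z b) + (\<Sum>b\<in>B. z b + coord y b)
          = (\<Sum>b\<in>B. \<bar>coord y b\<bar>) + 2 * (\<Sum>b\<in>B. coord (x + - m - x0) b)"
        unfolding sum_distrib_left sum.distrib[symmetric]
        by (rule sum.cong[OF refl], subst z2) (auto simp: max_def)
      then have "exp (- (\<Sum>b\<in>B. z b)) * exp (- (\<Sum>b\<in>B. z b + coord y b))
          = exp (- (\<Sum>b\<in>B. \<bar>coord y b\<bar>)) * (exp (- (\<Sum>b\<in>B. coord (x + - m - x0) b)))\<^sup>2"
        unfolding exp_double[symmetric] exp_add[symmetric] by simp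
      moreover have "f x = a * exp (- (\<Sum>b\<in>B. z b))" "f (x + y) = a * exp (- (\<Sum>b\<in>B. z b + coord y b))"
        using True unfolding simplex_exp_eq z1 by (simp_all add: z_def)
      moreover have "f (x + - m) = a * exp (- (\<Sum>b\<in>B. coord (x + - m - x0) b))"
        using True unfolding simplex_exp_eq iff by simp
      ultimately show ?thesis by (simp add: power2_eq_square mult_ac)
    next
      case False
      then have "f (x + - m) = 0" unfolding simplex_exp_eq iff by (rule if_not_P)
      moreover have "f x = 0 \<or> f (x + y) = 0"
        using False unfolding simplex_exp_eq z1 z_def by (auto split: if_splits)
      ultimately show ?thesis by auto
    qed
  qed
  show ?thesis
    unfolding covar_def eq using integral_translate_square[OF in_L2_simplex_exp, of "- m"] by simp
qed

text \<open>Along a ray the covariogram is a pure exponential whose rate is the sum of the absolute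
  coordinates of \<xi>. The resulting radius is free of \<alpha>, which is the equality
  case.\<close>

lemma normalized_radial_mean_simplex_exp:
  assumes \<xi>: "norm \<xi> = 1" and \<alpha>: "-1 < \<alpha>"
  shows "radial_mean_rho \<alpha> f \<xi> / gamma_factor \<alpha> = 1 / (\<Sum>b\<in>B. \<bar>coord \<xi> b\<bar>)"
proof -
  define k where "k = (\<Sum>b\<in>B. \<bar>coord \<xi> b\<bar>)"
  have "k \<noteq> 0"
  proof
    assume "k = 0"
    then have "\<forall>b\<in>B. coord \<xi> b = 0" using finite_B by (simp add: k_def sum_nonneg_eq_0_iff)
    then have "\<xi> = 0" using sum_coord[of \<xi>] by simp
    then show False using \<xi> by simp
  qed
  then have k: "0 < k" by (simp add: k_def less_le sum_nonneg)
  have "covar f (t *\<^sub>R \<xi>) / l2sq f = exp (- (k * t))" if "0 < t" for t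
    using that l2sq_simplex_exp_pos
    by (simp add: covar_simplex_exp coord_scale abs_mult k_def sum_distrib_left[symmetric] mult.commute)
  then have "radial_mean_rho \<alpha> f \<xi> = mean_radius \<alpha> (\<lambda>t. exp (- (k * t)))"
    using radial_mean_rho_eq_mean_radius[OF in_L2_simplex_exp, of \<alpha> \<xi>] l2sq_simplex_exp_pos
    by (simp cong: mean_radius_cong)
  then show ?thesis using normalized_mean_radius_exp[OF k \<alpha>] by (simp add: k_def)
qed

end

end

lemma full_simplex_vertex0_obtain_basis:
  fixes \<Delta> :: "'a::euclidean_space set"
  assumes "full_simplex_vertex0 \<Delta>"
  obtains B where "spanning_independent B" "\<Delta> = convex hull (insert 0 B)"
proof -
  obtain C where C: "\<not> affine_dependent C" "card C = DIM('a) + 1" "0 \<in> C" "\<Delta> = convex hull C"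
    using assms by (auto simp: full_simplex_vertex0_def)
  define B where "B = C - {0}"
  have "independent B"
    using C(1) affine_dependent_iff_dependent2[OF C(3)] by (simp add: B_def)
  moreover have "card B = DIM('a)"
    using C(2,3) by (simp add: B_def)
  ultimately have "span B = UNIV"
    by (metis card_eq_dim dim_UNIV independent_imp_finite order_refl span_UNIV span_eq_dim subset_UNIV top.extremum_uniqueI)
  then have "spanning_independent B" using \<open>independent B\<close> by unfold_locales
  moreover have "insert 0 B = C" using C(3) by (auto simp: B_def)
  ultimately show ?thesis using that C(4) by blast
qed

theorem theorem19:
  fixes dummy :: "'a::euclidean_space"
  shows "(\<forall>f :: 'a \<Rightarrow> real. in_L2 f \<and> l2sq f \<noteq> 0 \<and> log_concave f \<longrightarrow>
           (\<forall>\<alpha> \<beta>. -1 < \<alpha> \<and> \<alpha> < \<beta> \<longrightarrow>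
              (\<forall>\<xi>. norm \<xi> = 1 \<longrightarrow>
                 radial_mean_rho \<beta> f \<xi> / gamma_factor \<beta> \<le> radial_mean_rho \<alpha> f \<xi> / gamma_factor \<alpha>)))
       \<and> (\<forall>a (x0 :: 'a) \<Delta>. 0 < a \<and> full_simplex_vertex0 \<Delta> \<longrightarrow>
           (\<forall>\<alpha> \<beta>. -1 < \<alpha> \<and> \<alpha> < \<beta> \<longrightarrow>
              (\<forall>\<xi>. norm \<xi> = 1 \<longrightarrow>
                 radial_mean_rho \<beta> (simplex_exp a x0 \<Delta>) \<xi> / gamma_factor \<beta>
                 = radial_mean_rho \<alpha> (simplex_exp a x0 \<Delta>) \<xi> / gamma_factor \<alpha>)))"
proof (intro conjI allI impI)
  fix f :: "'a \<Rightarrow> real" and \<alpha> \<beta> :: real and \<xi> :: 'a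
  assume f: "in_L2 f \<and> l2sq f \<noteq> 0 \<and> log_concave f" and \<alpha>\<beta>: "-1 < \<alpha> \<and> \<alpha> < \<beta>" and \<xi>: "norm \<xi> = 1"
  interpret log_concave_profile "\<lambda>t. covar f (t *\<^sub>R \<xi>) / l2sq f"
    using f \<xi> by (intro covar_log_concave_profile) auto
  show "radial_mean_rho \<beta> f \<xi> / gamma_factor \<beta> \<le> radial_mean_rho \<alpha> f \<xi> / gamma_factor \<alpha>"
    using normalized_mean_radius_antimono \<alpha>\<beta> f by (simp add: radial_mean_rho_eq_mean_radius)
next
  fix a :: real and x0 :: 'a and \<Delta> :: "'a set" and \<alpha> \<beta> :: real and \<xi> :: 'a
  assume a: "0 < a \<and> full_simplex_vertex0 \<Delta>" and \<alpha>\<beta>: "-1 < \<alpha> \<and> \<alpha> < \<beta>" and \<xi>: "norm \<xi> = 1"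
  obtain B where B: "spanning_independent B" and \<Delta>: "\<Delta> = convex hull (insert 0 B)"
    using a full_simplex_vertex0_obtain_basis by blast
  interpret spanning_independent B by (rule B)
  show "radial_mean_rho \<beta> (simplex_exp a x0 \<Delta>) \<xi> / gamma_factor \<beta>
      = radial_mean_rho \<alpha> (simplex_exp a x0 \<Delta>) \<xi> / gamma_factor \<alpha>"
    unfolding \<Delta> using a \<alpha>\<beta> \<xi> by (simp add: normalized_radial_mean_simplex_exp)
qed

end
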